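(* Let $a<x<b$ be real numbers, let $\alpha,\beta\ge 0$ be real numbers, not both zero, and let $f:[a,b]\to\mathbb{R}$ be differentiable with $f'$ absolutely continuous on $[a,b]$. Put $$\tau=\frac{1}{2(\alpha+\beta)}\left[\alpha(x-a)-\beta(b-x)\right]f'(x)-f(x)+\frac{1}{\alpha+\beta}\left[\alpha M(f;a,x)+\beta M(f;x,b)\right].$$ Then: (i) if $f''\in L_\infty[a,b]$, then $$|\tau|\le\left[\alpha(x-a)^2+\beta(b-x)^2\right]\frac{\|f''\|_\infty}{6(\alpha+\beta)};$$ (ii) if $f''\in L_p[a,b]$ with $p>1$ and $\frac1p+\frac1q=1$, then $$|\tau|\le\frac{1}{(2q+1)^{1/q}}\left[\alpha^q(x-a)^{q+1}+\beta^q(b-x)^{q+1}\right]^{1/q}\frac{\|f''\|_p}{2(\alpha+\beta)};$$ (iii) if $f''\in L_1[a,b]$, then $$|\tau|\le\Big(\alpha(x-a)+\beta(b-x)+\left|\alpha(x-a)-\beta(b-x)\right|\Big)\frac{\|f''\|_1}{4(\alpha+\beta)}.$$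
   Context: For $c<d$, $M(f;c,d)=\frac{1}{d-c}\int_c^d f(t)\,dt$ is the integral mean of $f$ over $[c,d]$. The norms are $\|k\|_\infty=\operatorname{ess\,sup}_{t\in[a,b]}|k(t)|$ and $\|k\|_p=\left(\int_a^b|k(t)|^p\,dt\right)^{1/p}$ for $1\le p<\infty$. *)

theory Defs
  imports "HOL-Analysis.Analysis" "HOL-Probability.Essential_Supremum"
begin

(* Intended for intervals S.  The finitely many compact subintervals {u i..v i} may be
   degenerate and may share endpoints. *)
definition absolutely_continuous_on :: "real set \<Rightarrow> (real \<Rightarrow> real) \<Rightarrow> bool" where
  "absolutely_continuous_on S f \<longleftrightarrow>
     (\<forall>\<epsilon>>0. \<exists>\<delta>>0. \<forall>(n::nat) u v.
        (\<forall>i<n. u i \<le> v i \<and> {u i..v i} \<subseteq> S) \<and>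
        disjoint_family_on (\<lambda>i. {u i<..<v i}) {..<n} \<and>
        (\<Sum>i<n. v i - u i) < \<delta>
        \<longrightarrow> (\<Sum>i<n. \<bar>f (v i) - f (u i)\<bar>) < \<epsilon>)"

definition integral_mean :: "(real \<Rightarrow> real) \<Rightarrow> real \<Rightarrow> real \<Rightarrow> real" where
  "integral_mean f c d = 1 / (d - c) * (LINT t|lebesgue_on {c..d}. f t)"

(* Elements are functions rather than classes modulo null sets.  Lebesgue (not only Borel)
   measurability makes membership, and the norms below, invariant under changes on null sets. *)
definition Lp_space :: "real \<Rightarrow> real \<Rightarrow> real \<Rightarrow> (real \<Rightarrow> real) set" where
  "Lp_space p a b =
     {k. k \<in> borel_measurable (lebesgue_on {a..b}) \<and>
         integrable (lebesgue_on {a..b}) (\<lambda>t. \<bar>k t\<bar> powr p)}"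

definition Lp_norm :: "real \<Rightarrow> real \<Rightarrow> real \<Rightarrow> (real \<Rightarrow> real) \<Rightarrow> real" where
  "Lp_norm p a b k = (LINT t|lebesgue_on {a..b}. \<bar>k t\<bar> powr p) powr (1 / p)"

definition Linf_space :: "real \<Rightarrow> real \<Rightarrow> (real \<Rightarrow> real) set" where
  "Linf_space a b =
     {k. k \<in> borel_measurable (lebesgue_on {a..b}) \<and>
         esssup (lebesgue_on {a..b}) (\<lambda>t. ereal \<bar>k t\<bar>) < \<infinity>}"

(* The essential supremum is an ereal; for a < b it is finite on Linf_space. *)
definition Linf_norm :: "real \<Rightarrow> real \<Rightarrow> (real \<Rightarrow> real) \<Rightarrow> real" where
  "Linf_norm a b k = real_of_ereal (esssup (lebesgue_on {a..b}) (\<lambda>t. ereal \<bar>k t\<bar>))"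

(* The second derivative of f on [a,b] is written deriv f', where f' is the derivative of f
   on [a,b] (one-sided at a and b).  At points of (a,b) where f' is differentiable this is the
   usual second derivative, independent of the values of f' outside [a,b].  If f' is
   absolutely continuous, the remaining points, where deriv has an unspecified value, form a
   null set, so they affect neither the spaces nor the norms above. *)

end

(* Two integrations by parts on each of [a,x] and [x,b] give
     (alpha + beta) tau = integral over [a,b] of K f'',
   where K(t) = alpha (t - a)^2 / (2 (x - a)) for t <= x and K(t) = beta (b - t)^2 / (2 (b - x))
   for t > x.  The three estimates are Hoelder's inequality with the L_1, L_q and sup norm of K.
   The integrations by parts rest on Lebesgue's theorem for absolutely continuous functions:
   they are differentiable almost everywhere and are integrals of their derivatives. *)
theory Submission
  imports Defs
begin

section \<open>Absolutely continuous functions\<close>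

text \<open>The kernel vanishes to second order at \<open>a\<close> and \<open>b\<close>, so no
  boundary values of \<open>f\<close> or \<open>f'\<close> survive there. Its jump at
  \<open>x\<close> produces the term with \<open>f' x\<close>; the jump of its slope, from
  \<open>\<alpha>\<close> to \<open>- \<beta>\<close>, produces
  \<open>- (\<alpha> + \<beta>) * f x\<close>; its second derivatives, the constants
  \<open>\<alpha> / (x - a)\<close> and \<open>\<beta> / (b - x)\<close>, turn the integrals of
  \<open>f\<close> into means. Most of the work is Lebesgue's theorem for a function about which
  only the epsilon-delta condition is known. It is drawn from that condition directly, with no
  detour through monotone functions: Vitali coverings show that the chords around almost every point
  have slopes that neither grow beyond all bounds nor oscillate across a rational gap. The
  representation is an identity between gauge integrals, proved without Lebesgue integrability of
  the second derivative. Each norm hypothesis supplies the Lebesgue integrability of its product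
  with the kernel.\<close>

lemma division_telescope:
  fixes h :: "real \<Rightarrow> real"
  assumes "a \<le> b" and "p division_of {a..b}"
  shows "(\<Sum>K\<in>p. h (Sup K) - h (Inf K)) = h b - h a"
proof -
  \<comment> \<open>Tagging every interval with its left endpoint makes the division a tagged one,
    for which telescoping is known.\<close>
  let ?t = "(\<lambda>K. (Inf K, K)) ` p"
  have "?t tagged_division_of {a..b}"
  proof (rule tagged_division_ofI)
    show "finite ?t" using assms(2) by auto
  next
    fix x K assume "(x, K) \<in> ?t"
    then have K: "K \<in> p" "x = Inf K" by auto
    obtain u v where uv: "K = cbox u v" "K \<noteq> {}" "K \<subseteq> {a..b}"
      using division_ofD[OF assms(2)] K(1) by metis
    then show "x \<in> K" "K \<subseteq> {a..b}" "\<exists>a b. K = cbox a b" using K(2) by auto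
  next
    fix x1 K1 x2 K2 assume "(x1, K1) \<in> ?t" "(x2, K2) \<in> ?t" "(x1, K1) \<noteq> (x2, K2)"
    then show "interior K1 \<inter> interior K2 = {}"
      using division_ofD(5)[OF assms(2)] by auto
  next
    have "\<Union> {K. \<exists>x. (x, K) \<in> ?t} = \<Union> p" by auto
    then show "\<Union> {K. \<exists>x. (x, K) \<in> ?t} = {a..b}"
      using division_ofD(6)[OF assms(2)] by simp
  qed
  from additive_tagged_division_1[OF assms(1) this, of h]
  show ?thesis by (subst (asm) sum.reindex) (auto simp: inj_on_def)
qed

lemma division_of_real_intervalE:
  fixes D :: "real set set"
  assumes "D division_of T" "K \<in> D"
  obtains u v where "u \<le> v" "K = {u..v}" "Inf K = u" "Sup K = v"
proof -
  obtain u v where uv: "K = cbox u v" "K \<noteq> {}"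
    using division_ofD[OF assms(1)] assms(2) by metis
  then have "u \<le> v" by auto
  with uv show ?thesis by (intro that[of u v]) auto
qed

text \<open>Members of a division may share endpoints, so additivity holds up to null overlaps: the
  intersection of two members is convex with empty interior.\<close>

lemma measure_division_of_real:
  fixes D :: "real set set"
  assumes D: "D division_of T"
  shows "measure lebesgue T = (\<Sum>K\<in>D. Sup K - Inf K)"
proof -
  have K: "\<exists>u v. u \<le> v \<and> K = {u..v}" if "K \<in> D" for K
    by (rule division_of_real_intervalE[OF D that]) auto
  have "measure lebesgue (\<Union>D) = (\<Sum>K\<in>D. measure lebesgue K)"
  proof (rule measure_negligible_finite_Union)
    show "finite D" using D by auto
    show "S \<in> lmeasurable" if "S \<in> D" for S using K[OF that] by auto
    show "pairwise (\<lambda>S T. negligible (S \<inter> T)) D"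
    proof (rule pairwiseI)
      fix S S' assume S: "S \<in> D" "S' \<in> D" "S \<noteq> S'"
      then have "convex (S \<inter> S')" using K[of S] K[of S'] by (auto intro: convex_Int)
      moreover have "interior (S \<inter> S') = {}" using division_ofD(5)[OF D S] by simp
      ultimately show "negligible (S \<inter> S')" by (simp add: negligible_convex_interior)
    qed
  qed
  also have "\<dots> = (\<Sum>K\<in>D. Sup K - Inf K)"
    by (rule sum.cong[OF refl]) (use K in force)
  finally show ?thesis using division_ofD(6)[OF D] by simp
qed

text \<open>Vitali families, gaps and gauge divisions all arrive as sets of intervals. This form
  replaces the indexed families of the definition, with one \<open>\<delta>\<close> for all
  divisions.\<close>

lemma absolutely_continuous_on_division:
  assumes "absolutely_continuous_on S g" and "\<epsilon> > 0"
  obtains \<delta> where "\<delta> > 0"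
    "\<And>D T. D division_of T \<Longrightarrow> T \<subseteq> S \<Longrightarrow> (\<Sum>K\<in>D. Sup K - Inf K) < \<delta>
      \<Longrightarrow> (\<Sum>K\<in>D. \<bar>g (Sup K) - g (Inf K)\<bar>) < \<epsilon>"
proof -
  obtain \<delta> where "\<delta> > 0" and d: "\<And>(n::nat) u v.
        (\<forall>i<n. u i \<le> v i \<and> {u i..v i} \<subseteq> S) \<and>
        disjoint_family_on (\<lambda>i. {u i<..<v i}) {..<n} \<and>
        (\<Sum>i<n. v i - u i) < \<delta>
        \<longrightarrow> (\<Sum>i<n. \<bar>g (v i) - g (u i)\<bar>) < \<epsilon>"
    using assms unfolding absolutely_continuous_on_def by meson
  have "(\<Sum>K\<in>D. \<bar>g (Sup K) - g (Inf K)\<bar>) < \<epsilon>"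
    if D: "D division_of T" "T \<subseteq> S" "(\<Sum>K\<in>D. Sup K - Inf K) < \<delta>" for D T
  proof -
    have "finite D" using D(1) by auto
    then obtain e where e: "bij_betw e {..<card D} D"
      using ex_bij_betw_nat_finite by (metis atLeast0LessThan)
    have eD: "e i \<in> D" if "i < card D" for i
      using e that by (auto simp: bij_betw_def)
    have int: "interior (e i) = {Inf (e i)<..<Sup (e i)}" if "i < card D" for i
      by (rule division_of_real_intervalE[OF D(1) eD[OF that]]) auto
    have "(\<Sum>i<card D. \<bar>g (Sup (e i)) - g (Inf (e i))\<bar>) < \<epsilon>"
    proof (rule d[rule_format, of _ "\<lambda>i. Inf (e i)" "\<lambda>i. Sup (e i)"], intro conjI allI impI)
      fix i assume i: "i < card D"
      have "e i \<subseteq> S" using division_ofD(2)[OF D(1) eD[OF i]] D(2) by auto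
      then show "Inf (e i) \<le> Sup (e i)" "{Inf (e i)..Sup (e i)} \<subseteq> S"
        by - (rule division_of_real_intervalE[OF D(1) eD[OF i]]; simp)+
    next
      show "disjoint_family_on (\<lambda>i. {Inf (e i)<..<Sup (e i)}) {..<card D}"
        unfolding disjoint_family_on_def
      proof (intro ballI impI)
        fix i j assume ij: "i \<in> {..<card D}" "j \<in> {..<card D}" "i \<noteq> j"
        then have "e i \<noteq> e j" using e by (auto simp: bij_betw_def inj_on_def)
        then show "{Inf (e i)<..<Sup (e i)} \<inter> {Inf (e j)<..<Sup (e j)} = {}"
          using division_ofD(5)[OF D(1) eD eD, of i j] int ij by auto
      qed
    next
      show "(\<Sum>i<card D. Sup (e i) - Inf (e i)) < \<delta>"
        using D(3) sum.reindex_bij_betw[OF e, of "\<lambda>K. Sup K - Inf K"] by simp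
    qed
    then show ?thesis
      using sum.reindex_bij_betw[OF e, of "\<lambda>K. \<bar>g (Sup K) - g (Inf K)\<bar>"] by simp
  qed
  with \<open>\<delta> > 0\<close> show ?thesis using that by blast
qed

section \<open>Transfer of absolute continuity to other sets and functions, and continuity\<close>

lemma absolutely_continuous_on_subset:
  assumes "absolutely_continuous_on S g" "T \<subseteq> S"
  shows "absolutely_continuous_on T g"
  using assms unfolding absolutely_continuous_on_def by (meson order_trans)

text \<open>A single comparison of increments covers both later changes of function: subtracting a
  linear term, and passing from \<open>f'\<close> to a quadratic multiple of it plus a Lipschitz
  term.\<close>

lemma absolutely_continuous_on_dominated:
  assumes g: "absolutely_continuous_on S g" and "B \<ge> 0" "C \<ge> 0"
    and le: "\<And>u v. u \<le> v \<Longrightarrow> {u..v} \<subseteq> S \<Longrightarrow> \<bar>h v - h u\<bar> \<le> B * \<bar>g v - g u\<bar> + C * (v - u)"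
  shows "absolutely_continuous_on S h"
  unfolding absolutely_continuous_on_def
proof (intro allI impI)
  fix \<epsilon> :: real assume "\<epsilon> > 0"
  \<comment> \<open>Each of the two summands gets half of \<open>\<epsilon>\<close>. Adding 1 to
    \<open>B\<close>, and below to \<open>C\<close>, keeps the divisors positive and the bounds
    strict.\<close>
  define \<epsilon>' where "\<epsilon>' = \<epsilon> / (2 * (B + 1))"
  have "\<epsilon>' > 0" using \<open>\<epsilon> > 0\<close> \<open>B \<ge> 0\<close> by (simp add: \<epsilon>'_def)
  then obtain \<delta> where "\<delta> > 0" and d: "\<And>(n::nat) u v.
        (\<forall>i<n. u i \<le> v i \<and> {u i..v i} \<subseteq> S) \<and>
        disjoint_family_on (\<lambda>i. {u i<..<v i}) {..<n} \<and>
        (\<Sum>i<n. v i - u i) < \<delta>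
        \<longrightarrow> (\<Sum>i<n. \<bar>g (v i) - g (u i)\<bar>) < \<epsilon>'"
    using g unfolding absolutely_continuous_on_def by meson
  show "\<exists>\<delta>>0. \<forall>(n::nat) u v.
        (\<forall>i<n. u i \<le> v i \<and> {u i..v i} \<subseteq> S) \<and>
        disjoint_family_on (\<lambda>i. {u i<..<v i}) {..<n} \<and>
        (\<Sum>i<n. v i - u i) < \<delta>
        \<longrightarrow> (\<Sum>i<n. \<bar>h (v i) - h (u i)\<bar>) < \<epsilon>"
  proof (intro exI[of _ "min \<delta> (\<epsilon> / (2 * (C + 1)))"] conjI allI impI)
    show "0 < min \<delta> (\<epsilon> / (2 * (C + 1)))" using \<open>\<delta> > 0\<close> \<open>\<epsilon> > 0\<close> \<open>C \<ge> 0\<close> by simp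
  next
    fix n :: nat and u v :: "nat \<Rightarrow> real"
    assume A: "(\<forall>i<n. u i \<le> v i \<and> {u i..v i} \<subseteq> S) \<and>
        disjoint_family_on (\<lambda>i. {u i<..<v i}) {..<n} \<and>
        (\<Sum>i<n. v i - u i) < min \<delta> (\<epsilon> / (2 * (C + 1)))"
    have 1: "(\<Sum>i<n. \<bar>g (v i) - g (u i)\<bar>) < \<epsilon>'" using d[of n u v] A by auto
    have "(\<Sum>i<n. \<bar>h (v i) - h (u i)\<bar>) \<le> (\<Sum>i<n. B * \<bar>g (v i) - g (u i)\<bar> + C * (v i - u i))"
      by (rule sum_mono) (use A le in auto)
    also have "\<dots> = B * (\<Sum>i<n. \<bar>g (v i) - g (u i)\<bar>) + C * (\<Sum>i<n. v i - u i)"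
      by (simp add: sum.distrib sum_distrib_left)
    also have "\<dots> \<le> B * \<epsilon>' + C * (\<epsilon> / (2 * (C + 1)))"
      using 1 A \<open>B \<ge> 0\<close> \<open>C \<ge> 0\<close> by (intro add_mono mult_left_mono) auto
    also have "\<dots> < \<epsilon>"
    proof -
      have "B * \<epsilon>' < \<epsilon> / 2"
        using \<open>B \<ge> 0\<close> \<open>\<epsilon> > 0\<close> by (simp add: \<epsilon>'_def field_simps)
      moreover have "C * (\<epsilon> / (2 * (C + 1))) < \<epsilon> / 2"
        using \<open>C \<ge> 0\<close> \<open>\<epsilon> > 0\<close> by (simp add: field_simps)
      ultimately show ?thesis by linarith
    qed
    finally show "(\<Sum>i<n. \<bar>h (v i) - h (u i)\<bar>) < \<epsilon>" .
  qed
qed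

lemma absolutely_continuous_on_imp_continuous_on:
  assumes "absolutely_continuous_on {a..b} g"
  shows "continuous_on {a..b} g"
  unfolding continuous_on_iff
proof (intro ballI allI impI)
  fix x e :: real assume x: "x \<in> {a..b}" and "e > 0"
  obtain \<delta> where "\<delta> > 0"
    and d: "\<And>D T. D division_of T \<Longrightarrow> T \<subseteq> {a..b} \<Longrightarrow> (\<Sum>K\<in>D. Sup K - Inf K) < \<delta>
      \<Longrightarrow> (\<Sum>K\<in>D. \<bar>g (Sup K) - g (Inf K)\<bar>) < e"
    by (rule absolutely_continuous_on_division[OF assms \<open>e > 0\<close>]) blast
  have "\<bar>g v - g u\<bar> < e" if "u \<le> v" "u \<in> {a..b}" "v \<in> {a..b}" "v - u < \<delta>" for u v
    using d[of "{cbox u v}" "cbox u v"] that division_of_self[of u v] by auto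
  note close = this
  have "dist (g y) (g x) < e" if "y \<in> {a..b}" "dist y x < \<delta>" for y
    using close[of x y] close[of y x] x that
    by (cases "x \<le> y") (auto simp: dist_real_def abs_minus_commute)
  then show "\<exists>d>0. \<forall>y\<in>{a..b}. dist y x < d \<longrightarrow> dist (g y) (g x) < e"
    using \<open>\<delta> > 0\<close> by blast
qed

section \<open>Coverings and divisions of intervals\<close>

lemma small_interval_subset_open:
  fixes x :: real
  assumes "open U" "x \<in> U"
  obtains r where "r > 0" "\<And>u v. u \<le> x \<Longrightarrow> x \<le> v \<Longrightarrow> v - u < r \<Longrightarrow> {u..v} \<subseteq> U"
proof -
  obtain r where "r > 0" "ball x r \<subseteq> U" using assms open_contains_ball by blast
  moreover have "{u..v} \<subseteq> ball x r" if "u \<le> x" "x \<le> v" "v - u < r" for u v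
    using that by (auto simp: dist_real_def)
  ultimately show ?thesis using that by blast
qed

text \<open>An interval is the closed ball about its midpoint, which may differ from the point for
  which it was chosen, so Vitali's theorem for balls applies. It leaves a null set outside countably
  many disjoint intervals; by continuity of the measure, finitely many of them leave less than
  \<open>e\<close>.\<close>

lemma Vitali_finite_intervals:
  fixes S :: "real set"
  assumes S: "S \<in> lmeasurable" and "e > 0"
    and cover: "\<And>x d. x \<in> S \<Longrightarrow> d > 0 \<Longrightarrow> \<exists>u v. u < v \<and> u \<le> x \<and> x \<le> v \<and> v - u < d \<and> P u v"
  obtains D where "finite D" "\<And>K. K \<in> D \<Longrightarrow> \<exists>u v. u < v \<and> K = {u..v} \<and> P u v"
    "disjoint D" "measure lebesgue (S - \<Union>D) < e"
proof -
  define K where "K = {(u, v). u < v \<and> P u v}"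
  define c :: "real \<times> real \<Rightarrow> real" where "c = (\<lambda>(u, v). (u + v) / 2)"
  define r :: "real \<times> real \<Rightarrow> real" where "r = (\<lambda>(u, v). (v - u) / 2)"
  have cb: "cball (c i) (r i) = {fst i..snd i}" for i
    by (cases i) (simp add: c_def r_def cball_eq_atLeastAtMost field_simps)
  have 1: "0 < r i" if "i \<in> K" for i using that by (auto simp: K_def r_def)
  have 2: "\<exists>i. i \<in> K \<and> x \<in> cball (c i) (r i) \<and> r i < d" if xd: "x \<in> S" "0 < d" for x d
  proof -
    obtain u v where "u < v" "u \<le> x" "x \<le> v" "v - u < d" "P u v"
      using cover[OF xd] by blast
    then show ?thesis
      using cb[of "(u, v)"] by (intro exI[of _ "(u, v)"]) (auto simp: K_def r_def simp del: mem_cball)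
  qed
  obtain C where C: "countable C" "C \<subseteq> K"
    "pairwise (\<lambda>i j. disjnt (cball (c i) (r i)) (cball (c j) (r j))) C"
    "negligible (S - (\<Union>i \<in> C. cball (c i) (r i)))"
    using Vitali_covering_theorem_cballs[of K r S c, OF 1 2] by blast
  define I where "I = (\<lambda>i::real \<times> real. {fst i..snd i})"
  have meas: "I i \<in> lmeasurable" for i unfolding I_def by simp
  \<comment> \<open>The traces on \<open>S\<close> are used because their finite unions have measure
    at most that of \<open>S\<close>; the intervals themselves carry no such bound. Removing the
    traces from \<open>S\<close> is the same as removing the intervals.\<close>
  define F where "F = (\<lambda>i. S \<inter> I i) ` C"
  obtain D' where D': "D' \<subseteq> F" "finite D'" "measure lebesgue (\<Union>F) - e < measure lebesgue (\<Union>D')"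
  proof (rule measure_countable_Union_approachable[of F e "measure lebesgue S"])
    show "countable F" using C(1) by (simp add: F_def)
    show "e > 0" by fact
    show lm: "d \<in> lmeasurable" if "d \<in> F" for d
      using that meas S by (auto simp: F_def)
    show "measure lebesgue (\<Union>D') \<le> measure lebesgue S" if "D' \<subseteq> F" "finite D'" for D'
    proof (rule measure_mono_fmeasurable[OF _ _ S])
      show "\<Union>D' \<subseteq> S" using that by (auto simp: F_def)
      have "\<Union>D' \<in> lmeasurable"
        using that lm by (intro fmeasurable.finite_Union) auto
      then show "\<Union>D' \<in> sets lebesgue" by auto
    qed
  qed blast
  obtain C' where C': "C' \<subseteq> C" "finite C'" "D' = (\<lambda>i. S \<inter> I i) ` C'"
    using finite_subset_image[OF D'(2) D'(1)[unfolded F_def]] by blast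
  show ?thesis
  proof (rule that[of "I ` C'"])
    show "finite (I ` C')" using C' by simp
    show "\<exists>u v. u < v \<and> L = {u..v} \<and> P u v" if L: "L \<in> I ` C'" for L
    proof -
      obtain i where "i \<in> K" "L = I i" using L C C' by auto
      then show ?thesis by (auto simp: K_def I_def)
    qed
    show "disjoint (I ` C')"
    proof (clarsimp simp: pairwise_def)
      fix i j assume "i \<in> C'" "j \<in> C'" "I i \<noteq> I j"
      then have "i \<in> C" "j \<in> C" "i \<noteq> j" using C'(1) by auto
      with C(3) show "disjnt (I i) (I j)" unfolding pairwise_def cb I_def by blast
    qed
    have UD: "\<Union>D' \<in> lmeasurable" "\<Union>D' \<subseteq> S"
      unfolding C'(3) using meas S C'(2) by (auto intro!: fmeasurable.finite_UN)
    have S': "\<Union>F = S - (S - (\<Union>i \<in> C. cball (c i) (r i)))"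
      by (auto simp: F_def cb I_def)
    have "measure lebesgue (\<Union>F) = measure lebesgue S"
      unfolding S' using C(4) S
      by (subst measure_Diff_null_set) (auto simp: negligible_iff_null_sets)
    moreover have "measure lebesgue (S - \<Union>D') = measure lebesgue S - measure lebesgue (\<Union>D')"
      using UD S by (intro measurable_measure_Diff) auto
    moreover have "S - \<Union>(I ` C') = S - \<Union>D'"
      using C' by auto
    ultimately show "measure lebesgue (S - \<Union>(I ` C')) < e" using D'(3) by simp
  qed
qed

lemma finite_disjoint_intervals:
  fixes D :: "real set set"
  assumes "finite D" "\<And>K. K \<in> D \<Longrightarrow> \<exists>u v. u < v \<and> K = {u..v}" "disjoint D"
  shows "D division_of \<Union>D" and "measure lebesgue (\<Union>D) = (\<Sum>K\<in>D. Sup K - Inf K)"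
    and "\<Union>D \<in> lmeasurable"
proof -
  show div: "D division_of \<Union>D"
  proof (rule division_ofI)
    show "finite D" by fact
    show "\<exists>a b. K = cbox a b" "K \<noteq> {}" "K \<subseteq> \<Union>D" if "K \<in> D" for K
      using assms(2)[OF that] that by auto
    show "interior K1 \<inter> interior K2 = {}" if "K1 \<in> D" "K2 \<in> D" "K1 \<noteq> K2" for K1 K2
      using assms(3) that interior_subset unfolding disjoint_def by blast
  qed simp
  show "measure lebesgue (\<Union>D) = (\<Sum>K\<in>D. Sup K - Inf K)"
    by (rule measure_division_of_real[OF div])
  show "\<Union>D \<in> lmeasurable" by (rule lmeasurable_division[OF div])
qed

text \<open>Inside each \<open>I\<close> of \<open>A\<close> the intervals of \<open>B\<close>
  contained in \<open>I\<close> extend to a division of \<open>I\<close>, and \<open>R\<close>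
  collects the added pieces. The identity holds for every \<open>h\<close> because two instances are
  wanted: the identity function gives the total length of the gaps, \<open>g\<close> its growth over
  them.\<close>

lemma division_of_gaps:
  fixes A B :: "real set set"
  assumes A: "finite A" "\<And>K. K \<in> A \<Longrightarrow> \<exists>u v. u < v \<and> K = {u..v}" "disjoint A"
    and B: "finite B" "\<And>K. K \<in> B \<Longrightarrow> \<exists>u v. u < v \<and> K = {u..v}" "disjoint B"
    and sub: "\<And>J. J \<in> B \<Longrightarrow> \<exists>I\<in>A. J \<subseteq> I"
  obtains R where "R division_of \<Union>R" "\<Union>R \<subseteq> \<Union>A"
    "\<And>h :: real \<Rightarrow> real. (\<Sum>K\<in>R. h (Sup K) - h (Inf K))
       = (\<Sum>K\<in>A. h (Sup K) - h (Inf K)) - (\<Sum>K\<in>B. h (Sup K) - h (Inf K))"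
proof -
  define BI where "BI I = {J \<in> B. J \<subseteq> I}" for I
  have "\<exists>p. BI I \<subseteq> p \<and> p division_of I" if "I \<in> A" for I
  proof -
    obtain u v where uv: "I = cbox u v" using A(2)[OF \<open>I \<in> A\<close>] by auto
    have "BI I division_of \<Union>(BI I)"
      using B by (intro finite_disjoint_intervals) (auto simp: BI_def disjoint_def)
    moreover have "\<Union>(BI I) \<subseteq> cbox u v" by (auto simp: BI_def uv)
    ultimately show ?thesis
      using partial_division_extend_interval uv by metis
  qed
  then obtain p where p: "\<And>I. I \<in> A \<Longrightarrow> BI I \<subseteq> p I" "\<And>I. I \<in> A \<Longrightarrow> p I division_of I"
    by metis
  define R where "R = (\<Union>I\<in>A. p I - BI I)"
  have finp: "finite (p I)" if "I \<in> A" for I using p(2)[OF that] by auto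
  have sp: "K \<subseteq> I" "K \<noteq> {}" if "I \<in> A" "K \<in> p I" for I K
    using division_ofD[OF p(2)] that by auto
  \<comment> \<open>The pieces are nonempty and the intervals of \<open>A\<close> are disjoint as
    sets, so a piece belongs to only one \<open>I\<close> and no increment is counted twice.\<close>
  have disjp: "p I \<inter> p I' = {}" if "I \<in> A" "I' \<in> A" "I \<noteq> I'" for I I'
  proof -
    have "I \<inter> I' = {}" using A(3) that by (auto simp: disjoint_def)
    then show ?thesis using sp[OF that(1)] sp[OF that(2)] by fastforce
  qed
  have B_eq: "B = (\<Union>I\<in>A. BI I)" using sub by (auto simp: BI_def)
  show ?thesis
  proof (rule that[of R])
    show "\<Union>R \<subseteq> \<Union>A" using sp by (auto simp: R_def) 
    show "R division_of \<Union>R"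
    proof (rule division_ofI)
      show "finite R" using A(1) finp by (auto simp: R_def)
      show "\<exists>a b. K = cbox a b" "K \<noteq> {}" "K \<subseteq> \<Union>R" if K: "K \<in> R" for K
      proof -
        obtain I where I: "I \<in> A" "K \<in> p I" using K by (auto simp: R_def)
        show "\<exists>a b. K = cbox a b" "K \<noteq> {}"
          using division_ofD(3,4)[OF p(2)[OF I(1)] I(2)] by auto
        show "K \<subseteq> \<Union>R" using K by auto
      qed
      show "interior K1 \<inter> interior K2 = {}" if K: "K1 \<in> R" "K2 \<in> R" "K1 \<noteq> K2" for K1 K2
      proof -
        obtain I1 I2 where I: "I1 \<in> A" "K1 \<in> p I1" "I2 \<in> A" "K2 \<in> p I2"
          using K by (auto simp: R_def)
        show ?thesis
        proof (cases "I1 = I2")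
          case True
          then show ?thesis using division_ofD(5)[OF p(2)[OF I(1)]] I K(3) by blast
        next
          case False
          then have "I1 \<inter> I2 = {}" using A(3) I by (auto simp: disjoint_def)
          then show ?thesis
            using sp(1)[OF I(1,2)] sp(1)[OF I(3,4)] interior_subset by blast
        qed
      qed
    qed simp
    fix h :: "real \<Rightarrow> real"
    let ?\<phi> = "\<lambda>K. h (Sup K) - h (Inf K)"
    have eq: "sum ?\<phi> (p I - BI I) = ?\<phi> I - sum ?\<phi> (BI I)" if I: "I \<in> A" for I
    proof -
      obtain u v where uv: "u < v" "I = {u..v}" using A(2)[OF I] by auto
      have "sum ?\<phi> (p I) = ?\<phi> I"
        using division_telescope[of u v "p I" h] p(2)[OF I] uv by simp
      then show ?thesis using p(1)[OF I] finp[OF I] by (subst sum_diff) auto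
    qed
    have "sum ?\<phi> R = (\<Sum>I\<in>A. sum ?\<phi> (p I - BI I))"
      unfolding R_def using A(1) finp disjp by (intro sum.UNION_disjoint) auto
    also have "\<dots> = (\<Sum>I\<in>A. ?\<phi> I - sum ?\<phi> (BI I))" using eq by simp
    also have "\<dots> = sum ?\<phi> A - (\<Sum>I\<in>A. sum ?\<phi> (BI I))" by (simp add: sum_subtractf)
    also have "(\<Sum>I\<in>A. sum ?\<phi> (BI I)) = sum ?\<phi> B"
    proof -
      have "BI I \<inter> BI I' = {}" if "I \<in> A" "I' \<in> A" "I \<noteq> I'" for I I'
        using disjp[OF that] p(1)[OF that(1)] p(1)[OF that(2)] by blast
      then show ?thesis
        unfolding B_eq using A(1) B(1)
        by (intro sum.UNION_disjoint[symmetric]) (auto simp: BI_def)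
    qed
    finally show "sum ?\<phi> R = sum ?\<phi> A - sum ?\<phi> B" .
  qed
qed

section \<open>Differentiability almost everywhere\<close>

text \<open>The strict inequalities make the set of straddled points of an interval a countable
  intersection of open sets, hence measurable, so that no outer measure is needed below.\<close>
definition straddled :: "(real \<Rightarrow> real \<Rightarrow> bool) \<Rightarrow> real \<Rightarrow> bool" where
  "straddled P x \<longleftrightarrow> (\<forall>d>0. \<exists>u v. u < x \<and> x < v \<and> v - u < d \<and> P u v)"

lemma lmeasurable_straddled:
  "{x \<in> {a<..<b}. straddled P x} \<in> lmeasurable"
proof -
  define W where "W n = \<Union>{{u<..<v} | u v. v - u < inverse (real (Suc n)) \<and> P u v}" for n
  have "straddled P x \<longleftrightarrow> (\<forall>n. x \<in> W n)" for x
  proof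
    assume S: "straddled P x"
    show "\<forall>n. x \<in> W n"
    proof
      fix n
      have "0 < inverse (real (Suc n))" by simp
      then obtain u v where "u < x" "x < v" "v - u < inverse (real (Suc n))" "P u v"
        using S unfolding straddled_def by blast
      then show "x \<in> W n" unfolding W_def by (intro UnionI[of "{u<..<v}"]) auto
    qed
  next
    assume W: "\<forall>n. x \<in> W n"
    show "straddled P x" unfolding straddled_def
    proof (intro allI impI)
      fix d :: real assume "d > 0"
      then obtain n where "inverse (real (Suc n)) < d" using reals_Archimedean by blast
      moreover have "x \<in> W n" using W by blast
      ultimately show "\<exists>u v. u < x \<and> x < v \<and> v - u < d \<and> P u v"
        unfolding W_def by fastforce
    qed
  qed
  then have "{x \<in> {a<..<b}. straddled P x} = {a<..<b} \<inter> (\<Inter>n. W n)" by auto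
  moreover have "open (W n)" for n unfolding W_def by auto
  then have "{a<..<b} \<inter> (\<Inter>n. W n) \<in> sets lebesgue"
    by (intro sets.Int sets.countable_INT'') auto
  ultimately have "{x \<in> {a<..<b}. straddled P x} \<in> sets lebesgue" by simp
  moreover have "bounded {x \<in> {a<..<b}. straddled P x}"
    by (rule bounded_subset[of "{a<..<b}"]) auto
  ultimately show ?thesis by (intro bounded_set_imp_lmeasurable)
qed

text \<open>Turns straddling into the covering hypothesis of \<open>Vitali_finite_intervals\<close>,
  with the intervals confined to an open set whose measure or position is under control.\<close>

lemma straddled_within_open:
  assumes "straddled P x" "open U" "x \<in> U" "d > 0"
  shows "\<exists>u v. u < v \<and> u \<le> x \<and> x \<le> v \<and> v - u < d \<and> P u v \<and> {u..v} \<subseteq> U"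
proof -
  obtain r where r: "r > 0" "\<And>u v. u \<le> x \<Longrightarrow> x \<le> v \<Longrightarrow> v - u < r \<Longrightarrow> {u..v} \<subseteq> U"
    using small_interval_subset_open[OF assms(2,3)] by blast
  then have "min d r > 0" using assms(4) by simp
  then obtain u v where "u < x" "x < v" "v - u < min d r" "P u v"
    using assms(1) unfolding straddled_def by blast
  then show ?thesis using r(2)[of u v] by (intro exI[of _ u] exI[of _ v]) auto
qed

text \<open>If a small piece of the set had positive measure, disjoint short intervals of slope
  above \<open>n\<close> would fill more than half of it, and for large \<open>n\<close> the
  increments of \<open>g\<close> would sum to more than 1. Absolute continuity limits this sum only
  for total length below \<open>\<delta>\<close>, so the argument is local.\<close>

lemma negligible_infinite_slopes:
  assumes g: "absolutely_continuous_on {a..b} g"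
  shows "negligible {x \<in> {a<..<b}. \<forall>n::nat. straddled (\<lambda>u v. real n * (v - u) < \<bar>g v - g u\<bar>) x}"
    (is "negligible ?E")
proof -
  have Eeq: "?E = (\<Inter>n::nat. {x \<in> {a<..<b}. straddled (\<lambda>u v. real n * (v - u) < \<bar>g v - g u\<bar>) x})"
    by auto
  have E: "?E \<in> lmeasurable"
    unfolding Eeq by (rule fmeasurable_INT[where i = "0::nat"])
      (simp_all only: lmeasurable_straddled fmeasurableD[OF lmeasurable_straddled] UNIV_I countableI_type)
  obtain \<delta> where "\<delta> > 0"
    and d: "\<And>D T. D division_of T \<Longrightarrow> T \<subseteq> {a..b} \<Longrightarrow> (\<Sum>K\<in>D. Sup K - Inf K) < \<delta>
      \<Longrightarrow> (\<Sum>K\<in>D. \<bar>g (Sup K) - g (Inf K)\<bar>) < 1"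
    by (rule absolutely_continuous_on_division[OF g zero_less_one]) blast
  show ?thesis
  proof (rule locally_negligible_alt[THEN iffD2], intro ballI)
    fix x assume x: "x \<in> ?E"
    \<comment> \<open>The radius \<open>\<delta> / 4\<close> makes the measure of \<open>U\<close>,
      hence the total length of disjoint intervals in it, at most
      \<open>\<delta> / 2\<close>.\<close>
    define U where "U = ball x (\<delta> / 4) \<inter> {a<..<b}"
    define E' where "E' = ?E \<inter> U"
    have "open U" unfolding U_def by auto
    have U: "U \<in> lmeasurable" unfolding U_def by (intro lmeasurable_open) auto
    have E': "E' \<in> lmeasurable" unfolding E'_def using E U by (rule fmeasurable.Int)
    have "measure lebesgue E' = 0"
    proof (rule ccontr)
      let ?s = "measure lebesgue E'"
      assume "?s \<noteq> 0"
      then have s: "?s > 0" by (simp add: zero_less_measure_iff)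
      \<comment> \<open>The intervals will have total length above \<open>?s / 2\<close>; this
        \<open>n\<close> makes their increments exceed 1.\<close>
      obtain n :: nat where n: "2 / ?s < real n" using reals_Archimedean2 by blast
      obtain D where D: "finite D"
        "\<And>K. K \<in> D \<Longrightarrow> \<exists>u v. u < v \<and> K = {u..v} \<and> real n * (v - u) < \<bar>g v - g u\<bar> \<and> {u..v} \<subseteq> U"
        "disjoint D" "measure lebesgue (E' - \<Union>D) < ?s / 2"
      proof (rule Vitali_finite_intervals[OF E', of "?s / 2"
              "\<lambda>u v. real n * (v - u) < \<bar>g v - g u\<bar> \<and> {u..v} \<subseteq> U"])
        fix y d :: real assume "y \<in> E'" "d > 0"
        then show "\<exists>u v. u < v \<and> u \<le> y \<and> y \<le> v \<and> v - u < d \<and>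
            real n * (v - u) < \<bar>g v - g u\<bar> \<and> {u..v} \<subseteq> U"
          using straddled_within_open[of "\<lambda>u v. real n * (v - u) < \<bar>g v - g u\<bar>" y U d] \<open>open U\<close>
          by (auto simp: E'_def)
      qed (use s in auto)
      have div: "D division_of \<Union>D" "measure lebesgue (\<Union>D) = (\<Sum>K\<in>D. Sup K - Inf K)"
        "\<Union>D \<in> lmeasurable"
        by (rule finite_disjoint_intervals; use D in blast)+
      have sub: "\<Union>D \<subseteq> U" using D(2) by blast
      have "measure lebesgue (\<Union>D) \<le> measure lebesgue U"
        using sub div(3) U by (intro measure_mono_fmeasurable) auto
      also have "\<dots> \<le> measure lebesgue (ball x (\<delta> / 4))"
        using U by (intro measure_mono_fmeasurable) (auto simp: U_def)
      also have "\<dots> = \<delta> / 2"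
        using \<open>\<delta> > 0\<close> by (simp add: ball_eq_greaterThanLessThan)
      finally have "(\<Sum>K\<in>D. \<bar>g (Sup K) - g (Inf K)\<bar>) < 1"
        using sub \<open>\<delta> > 0\<close> by (intro d[OF div(1)]) (auto simp: div(2) U_def)
      moreover have "real n * measure lebesgue (\<Union>D) \<le> (\<Sum>K\<in>D. \<bar>g (Sup K) - g (Inf K)\<bar>)"
        unfolding div(2) sum_distrib_left by (rule sum_mono) (use D(2) in force)
      moreover have "?s \<le> measure lebesgue (E' - \<Union>D) + measure lebesgue (\<Union>D)"
      proof -
        have "?s \<le> measure lebesgue ((E' - \<Union>D) \<union> \<Union>D)"
          using E' div(3) by (intro measure_mono_fmeasurable fmeasurable.Un fmeasurable.Diff) auto
        also have "\<dots> \<le> measure lebesgue (E' - \<Union>D) + measure lebesgue (\<Union>D)"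
          using E' div(3) by (intro measure_Un_le) auto
        finally show ?thesis .
      qed
      ultimately have 1: "real n * measure lebesgue (\<Union>D) < 1" "?s / 2 < measure lebesgue (\<Union>D)"
        using D(4) by linarith+
      have "1 < real n * (?s / 2)" using n s by (simp add: field_simps)
      also have "\<dots> \<le> real n * measure lebesgue (\<Union>D)"
        using 1(2) by (intro mult_left_mono) auto
      finally show False using 1(1) by simp
    qed
    then have "negligible E'" using E' by (simp add: negligible_iff_measure)
    moreover have "openin (top_of_set ?E) E'"
      unfolding E'_def using \<open>open U\<close> by (rule openin_open_Int)
    moreover have "x \<in> E'" using x \<open>\<delta> > 0\<close> by (auto simp: E'_def U_def)
    ultimately show "\<exists>U. openin (top_of_set ?E) U \<and> x \<in> U \<and> negligible U" by blast
  qed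
qed

text \<open>By Vitali's theorem the exceptional set \<open>E\<close> is covered, up to small measure, by finitely many
  disjoint intervals \<open>A\<close> of slope above \<open>c\<close> filling little more than \<open>E\<close>, and again by
  finitely many disjoint intervals \<open>B\<close> inside those of \<open>A\<close> of slope below \<open>-c\<close>. The gaps left in
  \<open>A\<close> by \<open>B\<close> have small total length, but \<open>g\<close> grows over them by about \<open>2 * c\<close> times the measure
  of \<open>E\<close>, contrary to absolute continuity.\<close>
lemma negligible_distinct_slopes_aux:
  assumes g: "absolutely_continuous_on {a..b} g" and "c > 0"
  shows "negligible {x \<in> {a<..<b}. straddled (\<lambda>u v. c * (v - u) < g v - g u) x
                                  \<and> straddled (\<lambda>u v. g v - g u < - c * (v - u)) x}"
    (is "negligible ?E")
proof -
  have Eeq: "?E = {x \<in> {a<..<b}. straddled (\<lambda>u v. c * (v - u) < g v - g u) x}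
                \<inter> {x \<in> {a<..<b}. straddled (\<lambda>u v. g v - g u < - c * (v - u)) x}" by auto
  have E: "?E \<in> lmeasurable"
    unfolding Eeq by (intro fmeasurable.Int lmeasurable_straddled)
  have "measure lebesgue ?E = 0"
  proof (rule ccontr)
    let ?s = "measure lebesgue ?E"
    assume "?s \<noteq> 0"
    then have s: "?s > 0" by (simp add: zero_less_measure_iff)
    then have "c * ?s > 0" using \<open>c > 0\<close> by simp
    \<comment> \<open>The threshold \<open>c * ?s\<close> is about half of the growth that the gaps
      will turn out to carry.\<close>
    then obtain \<delta> where "\<delta> > 0"
      and d: "\<And>D T. D division_of T \<Longrightarrow> T \<subseteq> {a..b} \<Longrightarrow> (\<Sum>K\<in>D. Sup K - Inf K) < \<delta>
        \<Longrightarrow> (\<Sum>K\<in>D. \<bar>g (Sup K) - g (Inf K)\<bar>) < c * ?s"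
      using absolutely_continuous_on_division[OF g, of "c * ?s"] by blast
    \<comment> \<open>At most \<open>\<eta>\<close> is lost each time: by enlarging the exceptional
      set to \<open>U\<close>, by covering it with \<open>A\<close>, and by covering it with
      \<open>B\<close>. The gaps are then shorter than \<open>3 * \<eta>\<close>, which must stay
      below \<open>\<delta>\<close>. In the closing comparison the loss of \<open>A\<close> counts
      twice and that of \<open>B\<close> once, so \<open>3 * \<eta>\<close> must also stay below
      \<open>?s\<close>.\<close>
    define \<eta> where "\<eta> = min (\<delta> / 4) (?s / 4)"
    have \<eta>: "\<eta> > 0" "3 * \<eta> < \<delta>" "3 * \<eta> < ?s"
      using s \<open>\<delta> > 0\<close> by (auto simp: \<eta>_def)
    obtain V where V: "open V" "?E \<subseteq> V" "V - ?E \<in> lmeasurable" "emeasure lebesgue (V - ?E) < ennreal \<eta>"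
      using sets_lebesgue_outer_open[of ?E \<eta>] E \<eta>(1) by blast
    define U where "U = V \<inter> {a<..<b}"
    have "open U" using V by (auto simp: U_def)
    have U: "U \<in> lmeasurable" using \<open>open U\<close> by (intro lmeasurable_open) (auto simp: U_def)
    have EU: "?E \<subseteq> U" using V by (auto simp: U_def)
    have measU: "measure lebesgue U < ?s + \<eta>"
    proof -
      have "measure lebesgue (V - ?E) < \<eta>"
        using V(4) \<eta>(1) V(3) by (simp add: emeasure_eq_measure2 ennreal_less_iff)
      moreover have "measure lebesgue U \<le> measure lebesgue (?E \<union> (V - ?E))"
        using V(3) E U by (intro measure_mono_fmeasurable fmeasurable.Un) (auto simp: U_def)
      moreover have "measure lebesgue (?E \<union> (V - ?E)) \<le> ?s + measure lebesgue (V - ?E)"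
        using E V(3) by (intro measure_Un_le) auto
      ultimately show ?thesis by simp
    qed
    obtain A where A: "finite A"
      "\<And>K. K \<in> A \<Longrightarrow> \<exists>u v. u < v \<and> K = {u..v} \<and> c * (v - u) < g v - g u \<and> {u..v} \<subseteq> U"
      "disjoint A" "measure lebesgue (?E - \<Union>A) < \<eta>"
    proof (rule Vitali_finite_intervals[OF E \<eta>(1),
          of "\<lambda>u v. c * (v - u) < g v - g u \<and> {u..v} \<subseteq> U"])
      fix y d :: real assume "y \<in> ?E" "d > 0"
      then show "\<exists>u v. u < v \<and> u \<le> y \<and> y \<le> v \<and> v - u < d \<and>
          c * (v - u) < g v - g u \<and> {u..v} \<subseteq> U"
        using straddled_within_open[of "\<lambda>u v. c * (v - u) < g v - g u" y U d] \<open>open U\<close> EU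
        by blast
    qed (rule that)
    have divA: "A division_of \<Union>A" "measure lebesgue (\<Union>A) = (\<Sum>K\<in>A. Sup K - Inf K)"
      "\<Union>A \<in> lmeasurable"
      by (rule finite_disjoint_intervals; use A in blast)+
    have subA: "\<Union>A \<subseteq> U" using A(2) by blast
    \<comment> \<open>Interiors leave room for an interval of \<open>B\<close> around the point
      within a single member of \<open>A\<close>. Only the finitely many endpoints are given
      up.\<close>
    define W where "W = (\<Union>I\<in>A. interior I)"
    define E' where "E' = ?E \<inter> W"
    have "open W" unfolding W_def by auto
    have E': "E' \<in> lmeasurable"
      unfolding E'_def using E \<open>open W\<close> by (intro fmeasurable_Int_fmeasurable) auto
    obtain B where B: "finite B"
      "\<And>K. K \<in> B \<Longrightarrow> \<exists>u v. u < v \<and> K = {u..v} \<and> g v - g u < - c * (v - u) \<and> (\<exists>I\<in>A. {u..v} \<subseteq> I)"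
      "disjoint B" "measure lebesgue (E' - \<Union>B) < \<eta>"
    proof (rule Vitali_finite_intervals[OF E' \<eta>(1),
          of "\<lambda>u v. g v - g u < - c * (v - u) \<and> (\<exists>I\<in>A. {u..v} \<subseteq> I)"])
      fix y d :: real assume y: "y \<in> E'" "d > 0"
      then obtain I where I: "I \<in> A" "y \<in> interior I" by (auto simp: E'_def W_def)
      then have "\<exists>u v. u < v \<and> u \<le> y \<and> y \<le> v \<and> v - u < d \<and>
          g v - g u < - c * (v - u) \<and> {u..v} \<subseteq> interior I"
        using straddled_within_open[of "\<lambda>u v. g v - g u < - c * (v - u)" y "interior I" d] y
        unfolding E'_def by blast
      then show "\<exists>u v. u < v \<and> u \<le> y \<and> y \<le> v \<and> v - u < d \<and>
          g v - g u < - c * (v - u) \<and> (\<exists>I\<in>A. {u..v} \<subseteq> I)"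
        using I(1) interior_subset by blast
    qed (rule that)
    have divB: "B division_of \<Union>B" "measure lebesgue (\<Union>B) = (\<Sum>K\<in>B. Sup K - Inf K)"
      "\<Union>B \<in> lmeasurable"
      by (rule finite_disjoint_intervals; use B in blast)+
    obtain R where R: "R division_of \<Union>R" "\<Union>R \<subseteq> \<Union>A"
      "\<And>h :: real \<Rightarrow> real. (\<Sum>K\<in>R. h (Sup K) - h (Inf K))
         = (\<Sum>K\<in>A. h (Sup K) - h (Inf K)) - (\<Sum>K\<in>B. h (Sup K) - h (Inf K))"
    proof (rule division_of_gaps[of A B])
      show "\<exists>u v. u < v \<and> K = {u..v}" if "K \<in> A" for K using A(2)[OF that] by blast
      show "\<exists>u v. u < v \<and> K = {u..v}" if "K \<in> B" for K using B(2)[OF that] by blast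
      show "\<exists>I\<in>A. J \<subseteq> I" if "J \<in> B" for J using B(2)[OF that] by blast
    qed (use A(1,3) B(1,3) in auto)
    let ?\<mu> = "measure lebesgue"
    have cover: "?\<mu> S \<le> ?\<mu> (S - T) + ?\<mu> T" if "S \<in> lmeasurable" "T \<in> lmeasurable" for S T :: "real set"
    proof -
      have "?\<mu> S \<le> ?\<mu> ((S - T) \<union> T)"
        using that by (intro measure_mono_fmeasurable fmeasurable.Un fmeasurable.Diff) auto
      also have "\<dots> \<le> ?\<mu> (S - T) + ?\<mu> T" using that by (intro measure_Un_le) auto
      finally show ?thesis .
    qed
    have A_le: "?\<mu> (\<Union>A) < ?s + \<eta>"
      using measU measure_mono_fmeasurable[OF subA _ U] divA(3) by auto
    have A_ge: "?s < \<eta> + ?\<mu> (\<Union>A)" using cover[OF E divA(3)] A(4) by simp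
    have "?s < ?\<mu> E' + \<eta>"
    proof -
      have fin: "finite (\<Union>A - W)"
      proof (rule finite_subset)
        show "\<Union>A - W \<subseteq> (\<Union>I\<in>A. {Inf I, Sup I})"
        proof
          fix y assume y: "y \<in> \<Union>A - W"
          then obtain I where I: "I \<in> A" "y \<in> I" "y \<notin> interior I" by (auto simp: W_def)
          then obtain u v where "u < v" "I = {u..v}" using A(2)[OF I(1)] by auto
          then show "y \<in> (\<Union>I\<in>A. {Inf I, Sup I})" using I by (force simp: interior_atLeastAtMost_real)
        qed
      qed (use A(1) in auto)
      then have n: "\<Union>A - W \<in> lmeasurable" "?\<mu> (\<Union>A - W) = 0"
        using negligible_finite negligible_iff_measure by blast+
      have "?s \<le> ?\<mu> (?E - E') + ?\<mu> E'" by (rule cover[OF E E'])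
      moreover have "?\<mu> (?E - E') \<le> ?\<mu> ((?E - \<Union>A) \<union> (\<Union>A - W))"
        by (intro measure_mono_fmeasurable fmeasurable.Un fmeasurable.Diff fmeasurableD
            E E' n(1) divA(3)) (auto simp: E'_def)
      moreover have "\<dots> \<le> ?\<mu> (?E - \<Union>A) + ?\<mu> (\<Union>A - W)"
        by (rule measure_Un_le[OF fmeasurableD[OF fmeasurable.Diff[OF E divA(3)]] fmeasurableD[OF n(1)]])
      ultimately show ?thesis using A(4) n(2) by simp
    qed
    then have B_ge: "?s < 2 * \<eta> + ?\<mu> (\<Union>B)" using cover[OF E' divB(3)] B(4) by simp
    have "(\<Sum>K\<in>R. Sup K - Inf K) = ?\<mu> (\<Union>A) - ?\<mu> (\<Union>B)"
      using R(3)[of "\<lambda>x. x"] divA(2) divB(2) by simp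
    also have "\<dots> < \<delta>" using A_le B_ge \<eta>(2) by linarith
    finally have short: "(\<Sum>K\<in>R. Sup K - Inf K) < \<delta>" .
    have "(\<Sum>K\<in>R. \<bar>g (Sup K) - g (Inf K)\<bar>) < c * ?s"
    proof (rule d[OF R(1)])
      have "U \<subseteq> {a..b}" by (auto simp: U_def)
      then show "\<Union>R \<subseteq> {a..b}" using R(2) subA by blast
    qed (rule short)
    moreover have "(\<Sum>K\<in>R. g (Sup K) - g (Inf K)) \<le> (\<Sum>K\<in>R. \<bar>g (Sup K) - g (Inf K)\<bar>)"
      by (rule sum_mono) simp
    moreover have "c * ?\<mu> (\<Union>A) \<le> (\<Sum>K\<in>A. g (Sup K) - g (Inf K))"
      unfolding divA(2) sum_distrib_left by (rule sum_mono) (use A(2) in force)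
    moreover have "(\<Sum>K\<in>B. g (Sup K) - g (Inf K)) \<le> - c * ?\<mu> (\<Union>B)"
      unfolding divB(2) sum_distrib_left by (rule sum_mono) (use B(2) in force)
    \<comment> \<open>The gap sum is the sum over \<open>A\<close> minus the sum over
      \<open>B\<close>. The latter is bounded above by a negative multiple of length, so the two
      contributions add.\<close>
    ultimately have "c * ?\<mu> (\<Union>A) + c * ?\<mu> (\<Union>B) < c * ?s"
      using R(3)[of g] by linarith
    then have "?\<mu> (\<Union>A) + ?\<mu> (\<Union>B) < ?s"
      using \<open>c > 0\<close> by (simp flip: distrib_left)
    then show False using A_ge B_ge \<eta>(3) by linarith
  qed
  then show ?thesis using E by (simp add: negligible_iff_measure)
qed

text \<open>Subtracting the line of slope \<open>(p + q) / 2\<close> makes the two slopes opposite,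
  \<open>(q - p) / 2\<close> and its negative, which is the symmetric case already settled.\<close>

lemma negligible_distinct_slopes:
  assumes g: "absolutely_continuous_on {a..b} g" and "p < q"
  shows "negligible {x \<in> {a<..<b}. straddled (\<lambda>u v. q * (v - u) < g v - g u) x
                                  \<and> straddled (\<lambda>u v. g v - g u < p * (v - u)) x}"
proof -
  define m where "m = (p + q) / 2"
  have "absolutely_continuous_on {a..b} (\<lambda>x. g x - m * x)"
  proof (rule absolutely_continuous_on_dominated[OF g, of 1 "\<bar>m\<bar>"])
    fix u v :: real assume "u \<le> v"
    have "\<bar>(g v - m * v) - (g u - m * u)\<bar> = \<bar>(g v - g u) - m * (v - u)\<bar>"
      by (simp add: algebra_simps)
    also have "\<dots> \<le> \<bar>g v - g u\<bar> + \<bar>m * (v - u)\<bar>" by (rule abs_triangle_ineq4)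
    finally show "\<bar>(g v - m * v) - (g u - m * u)\<bar> \<le> 1 * \<bar>g v - g u\<bar> + \<bar>m\<bar> * (v - u)"
      using \<open>u \<le> v\<close> by (simp add: abs_mult)
  qed auto
  from negligible_distinct_slopes_aux[OF this, of "(q - p) / 2"]
  have "negligible {x \<in> {a<..<b}.
      straddled (\<lambda>u v. (q - p) / 2 * (v - u) < g v - m * v - (g u - m * u)) x
    \<and> straddled (\<lambda>u v. g v - m * v - (g u - m * u) < - ((q - p) / 2) * (v - u)) x}"
    using \<open>p < q\<close> by simp
  moreover have "(q - p) / 2 * (v - u) < g v - m * v - (g u - m * u) \<longleftrightarrow> q * (v - u) < g v - g u"
    "g v - m * v - (g u - m * u) < - ((q - p) / 2) * (v - u) \<longleftrightarrow> g v - g u < p * (v - u)" for u v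
  proof -
    have "q * (v - u) = (q - p) / 2 * (v - u) + (m * v - m * u)"
      "p * (v - u) = - ((q - p) / 2) * (v - u) + (m * v - m * u)"
      by (simp_all add: m_def field_simps)
    then show "(q - p) / 2 * (v - u) < g v - m * v - (g u - m * u) \<longleftrightarrow> q * (v - u) < g v - g u"
      "g v - m * v - (g u - m * u) < - ((q - p) / 2) * (v - u) \<longleftrightarrow> g v - g u < p * (v - u)"
      by linarith+
  qed
  ultimately show ?thesis by simp
qed

text \<open>A difference quotient at \<open>x\<close> belongs to a chord with endpoint
  \<open>x\<close>, whereas straddling wants \<open>x\<close> strictly inside. The inequality is
  strict and \<open>g\<close> is continuous at \<open>x\<close>, so that endpoint can be moved
  slightly past \<open>x\<close>.\<close>

lemma straddled_if_frequently_slope_greater: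
  assumes cont: "isCont g x"
    and freq: "frequently (\<lambda>y. r < (g y - g x) / (y - x)) (at x)"
  shows "straddled (\<lambda>u v. r * (v - u) < g v - g u) x"
  unfolding straddled_def
proof (intro allI impI)
  fix d :: real assume "d > 0"
  have "\<exists>y. y \<noteq> x \<and> dist y x < d / 2 \<and> r < (g y - g x) / (y - x)"
  proof (rule ccontr)
    assume "\<not> ?thesis"
    then have "eventually (\<lambda>y. \<not> r < (g y - g x) / (y - x)) (at x)"
      using \<open>d > 0\<close> unfolding eventually_at by (intro exI[of _ "d / 2"]) auto
    then show False using freq by (simp add: frequently_def)
  qed
  then obtain y where y: "y \<noteq> x" "\<bar>y - x\<bar> < d / 2" "r < (g y - g x) / (y - x)"
    by (auto simp: dist_real_def)
  \<comment> \<open>The quantity \<open>s z\<close> measures how far the increment from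
    \<open>z\<close> to \<open>y\<close> exceeds that of a line of slope \<open>r\<close>. For
    \<open>y\<close> to the left of \<open>x\<close> the quotient reverses its sign.\<close>
  define s where "s z = (g y - g z) - r * (y - z)" for z
  have s_cont: "(s \<longlongrightarrow> s x) (at x)"
    unfolding s_def using cont by (intro tendsto_intros) (simp add: isCont_def)
  show "\<exists>u v. u < x \<and> x < v \<and> v - u < d \<and> r * (v - u) < g v - g u"
  proof (cases "x < y")
    case True
    then have "s x > 0" using y(3) by (simp add: s_def field_simps)
    then have "eventually (\<lambda>z. s z > 0) (at x)" using s_cont by (rule order_tendstoD(1)[rotated])
    then obtain e where e: "e > 0" "\<And>z. z \<noteq> x \<Longrightarrow> dist z x < e \<Longrightarrow> s z > 0"
      unfolding eventually_at by auto
    \<comment> \<open>Half of the minimum puts \<open>z\<close> within \<open>e\<close> of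
      \<open>x\<close> and at most \<open>d / 2\<close> away; \<open>y\<close> is strictly closer
      than \<open>d / 2\<close>, so the chord is shorter than \<open>d\<close>.\<close>
    define z where "z = x - min e d / 2"
    have "z < x" "dist z x < d / 2 \<or> dist z x = d / 2" "dist z x < e"
      using e(1) \<open>d > 0\<close> by (auto simp: z_def dist_real_def min_def)
    moreover from this have "s z > 0" using e(2) by simp
    ultimately
    show ?thesis using True y(2)
      by (intro exI[of _ z] exI[of _ y]) (auto simp: s_def dist_real_def)
  next
    case False
    then have "y < x" using y(1) by simp
    then have "s x < 0" using y(3) by (simp add: s_def field_simps)
    then have "eventually (\<lambda>z. s z < 0) (at x)" using s_cont by (rule order_tendstoD(2)[rotated])
    then obtain e where e: "e > 0" "\<And>z. z \<noteq> x \<Longrightarrow> dist z x < e \<Longrightarrow> s z < 0"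
      unfolding eventually_at by auto
    define z where "z = x + min e d / 2"
    have "x < z" "dist z x < d / 2 \<or> dist z x = d / 2" "dist z x < e"
      using e(1) \<open>d > 0\<close> by (auto simp: z_def dist_real_def min_def)
    moreover from this have "s z < 0" using e(2) by simp
    ultimately
    show ?thesis using \<open>y < x\<close> y(2)
      by (intro exI[of _ y] exI[of _ z]) (auto simp: s_def dist_real_def algebra_simps)
  qed
qed

lemma straddled_if_frequently_slope_less:
  assumes cont: "isCont g x"
    and freq: "frequently (\<lambda>y. (g y - g x) / (y - x) < r) (at x)"
  shows "straddled (\<lambda>u v. g v - g u < r * (v - u)) x"
proof -
  have "(- g y - - g x) / (y - x) = - ((g y - g x) / (y - x))" for y
    by (simp add: divide_simps)
  then have "- r < (- g y - - g x) / (y - x) \<longleftrightarrow> (g y - g x) / (y - x) < r" for y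
    by simp
  then have "straddled (\<lambda>u v. - r * (v - u) < - g v - - g u) x"
    using cont freq by (intro straddled_if_frequently_slope_greater) auto
  moreover have "- r * (v - u) < - g v - - g u \<longleftrightarrow> g v - g u < r * (v - u)" for u v
    by linarith
  ultimately show ?thesis by simp
qed

text \<open>The limit is the infimum of the eventual upper bounds. For \<open>z < p < q < L\<close>
  the number \<open>q\<close> is not such a bound, so the dichotomy makes \<open>p\<close> an
  eventual lower bound. Rational \<open>p\<close> and \<open>q\<close> suffice by density, and only
  countably many exceptional sets then have to be discarded.\<close>

lemma tendsto_if_no_oscillation:
  fixes Q :: "'a \<Rightarrow> real"
  assumes nt: "F \<noteq> bot" and bdd: "eventually (\<lambda>y. \<bar>Q y\<bar> \<le> M) F"
    and osc: "\<And>p q. p \<in> \<rat> \<Longrightarrow> q \<in> \<rat> \<Longrightarrow> p < q \<Longrightarrow>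
       eventually (\<lambda>y. Q y \<le> q) F \<or> eventually (\<lambda>y. p \<le> Q y) F"
  shows "\<exists>L. (Q \<longlongrightarrow> L) F"
proof -
  define R where "R = {r. eventually (\<lambda>y. Q y \<le> r) F}"
  have "M \<in> R" unfolding R_def using bdd by (auto elim: eventually_mono)
  have lower: "- M \<le> r" if "r \<in> R" for r
  proof -
    have "eventually (\<lambda>y. \<bar>Q y\<bar> \<le> M \<and> Q y \<le> r) F"
      using bdd that by (auto simp: R_def intro: eventually_conj)
    then obtain y where "\<bar>Q y\<bar> \<le> M" "Q y \<le> r" using eventually_happens'[OF nt] by blast
    then show ?thesis by linarith
  qed
  have bb: "bdd_below R" using lower by (rule bdd_belowI)
  define L where "L = Inf R"
  have "(Q \<longlongrightarrow> L) F"
  proof (rule order_tendstoI)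
    fix z assume "z < L"
    obtain p where p: "p \<in> \<rat>" "z < p" "p < L" using Rats_dense_in_real[OF \<open>z < L\<close>] by blast
    obtain q where q: "q \<in> \<rat>" "p < q" "q < L" using Rats_dense_in_real[OF \<open>p < L\<close>] by blast
    have "q \<notin> R" using q(3) bb cInf_lower unfolding L_def by (meson not_le)
    then have "eventually (\<lambda>y. p \<le> Q y) F" using osc[OF p(1) q(1,2)] by (auto simp: R_def)
    then show "eventually (\<lambda>y. z < Q y) F"
      by (rule eventually_mono) (use p(2) in auto)
  next
    fix z assume "L < z"
    then obtain r where "r \<in> R" "r < z"
      using cInf_lessD[of R z] \<open>M \<in> R\<close> unfolding L_def by blast
    then show "eventually (\<lambda>y. Q y < z) F"
      unfolding R_def by (auto elim: eventually_mono)
  qed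
  then show ?thesis ..
qed

text \<open>Outside \<open>E0\<close> the difference quotients are eventually bounded, and outside
  the countably many null sets \<open>E p q\<close> they do not oscillate, so they converge.\<close>

theorem absolutely_continuous_on_differentiable_ae:
  assumes g: "absolutely_continuous_on {a..b} g"
  obtains N where "negligible N"
    "\<And>x. x \<in> {a<..<b} - N \<Longrightarrow> (g has_real_derivative deriv g x) (at x)"
proof -
  define E0 where "E0 = {x \<in> {a<..<b}. \<forall>n::nat. straddled (\<lambda>u v. real n * (v - u) < \<bar>g v - g u\<bar>) x}"
  define E where "E p q = {x \<in> {a<..<b}. straddled (\<lambda>u v. q * (v - u) < g v - g u) x
                                  \<and> straddled (\<lambda>u v. g v - g u < p * (v - u)) x}" for p q
  define I where "I = {(p, q). p \<in> \<rat> \<and> q \<in> \<rat> \<and> p < (q :: real)}"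
  have "I \<subseteq> \<rat> \<times> \<rat>" by (auto simp: I_def)
  then have "countable I" by (rule countable_subset) (intro countable_SIGMA countable_rat)
  show ?thesis
  proof (rule that[of "E0 \<union> \<Union>((\<lambda>(p, q). E p q) ` I)"])
    show "negligible (E0 \<union> \<Union>((\<lambda>(p, q). E p q) ` I))"
    proof (rule negligible_Un)
      show "negligible E0" unfolding E0_def by (rule negligible_infinite_slopes[OF g])
      show "negligible (\<Union>((\<lambda>(p, q). E p q) ` I))"
      proof (rule negligible_countable_Union)
        show "negligible S" if S: "S \<in> (\<lambda>(p, q). E p q) ` I" for S
        proof -
          obtain p q where "p < q" "S = E p q" using S by (auto simp: I_def)
          then show ?thesis unfolding E_def using negligible_distinct_slopes[OF g] by simp
        qed
      qed (use \<open>countable I\<close> in simp)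
    qed
    fix x assume x: "x \<in> {a<..<b} - (E0 \<union> \<Union>((\<lambda>(p, q). E p q) ` I))"
    define Q where "Q y = (g y - g x) / (y - x)" for y
    have cont: "isCont g x"
      using absolutely_continuous_on_imp_continuous_on[OF g] x
      by (intro continuous_on_interior[of "{a..b}"]) (auto simp: interior_atLeastAtMost_real)
    note gt = straddled_if_frequently_slope_greater[OF cont, folded Q_def]
    note lt = straddled_if_frequently_slope_less[OF cont, folded Q_def]
    \<comment> \<open>The absolute value in \<open>E0\<close> lets one \<open>n\<close> bound the
      quotients from above and from below.\<close>
    obtain n :: nat where n: "\<not> straddled (\<lambda>u v. real n * (v - u) < \<bar>g v - g u\<bar>) x"
      using x by (auto simp: E0_def)
    have "\<not> straddled (\<lambda>u v. real n * (v - u) < g v - g u) x"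
      using n unfolding straddled_def by (metis abs_ge_self order_less_le_trans)
    then have up: "eventually (\<lambda>y. Q y \<le> real n) (at x)"
      using gt[of "real n"] by (auto simp: frequently_def not_less)
    have "\<not> straddled (\<lambda>u v. g v - g u < - real n * (v - u)) x"
    proof
      assume "straddled (\<lambda>u v. g v - g u < - real n * (v - u)) x"
      then have "straddled (\<lambda>u v. real n * (v - u) < \<bar>g v - g u\<bar>) x"
        unfolding straddled_def by (smt (verit) mult_minus_left)
      then show False using n by simp
    qed
    then have low: "eventually (\<lambda>y. - real n \<le> Q y) (at x)"
      using lt[of "- real n"] by (auto simp: frequently_def not_less)
    have "\<exists>L. (Q \<longlongrightarrow> L) (at x)"
    proof (rule tendsto_if_no_oscillation)
      show "eventually (\<lambda>y. \<bar>Q y\<bar> \<le> real n) (at x)"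
        using up low by eventually_elim auto
      fix p q :: real assume pq: "p \<in> \<rat>" "q \<in> \<rat>" "p < q"
      then have "x \<notin> E p q" using x by (auto simp: I_def)
      then have "\<not> frequently (\<lambda>y. q < Q y) (at x) \<or> \<not> frequently (\<lambda>y. Q y < p) (at x)"
        using gt lt x unfolding E_def by blast
      then show "eventually (\<lambda>y. Q y \<le> q) (at x) \<or> eventually (\<lambda>y. p \<le> Q y) (at x)"
        by (simp add: frequently_def not_less)
    qed simp
    then obtain L where "(g has_real_derivative L) (at x)"
      unfolding has_field_derivative_iff Q_def by blast
    then show "(g has_real_derivative deriv g x) (at x)"
      using DERIV_imp_deriv by blast
  qed
qed

section \<open>The fundamental theorem of calculus\<close>

text \<open>A gauge argument: tags outside \<open>N\<close> are handled by the derivative, and the intervals with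
  tags in \<open>N\<close> lie in an open set of small measure, where absolute continuity applies.\<close>
theorem absolutely_continuous_on_has_integral_deriv:
  assumes g: "absolutely_continuous_on {a..b} g" and "a \<le> b" and N: "negligible N"
    and der: "\<And>x. x \<in> {a..b} - N \<Longrightarrow> (g has_real_derivative g' x) (at x within {a..b})"
  shows "(g' has_integral (g b - g a)) {a..b}"
proof -
  \<comment> \<open>With the value 0 on \<open>N\<close>, a tag in \<open>N\<close> contributes only
    the increment of \<open>g\<close>. Changing the integrand on a null set restores
    \<open>g'\<close> at the end.\<close>
  define h where "h x = (if x \<in> N then 0 else g' x)" for x
  have "(h has_integral (g b - g a)) {a..b}"
    unfolding has_integral_real
  proof (intro allI impI)
    fix e :: real assume "e > 0"
    then have "e / 2 > 0" by simp
    then obtain \<delta> where "\<delta> > 0"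
      and ac: "\<And>D T. D division_of T \<Longrightarrow> T \<subseteq> {a..b} \<Longrightarrow> (\<Sum>K\<in>D. Sup K - Inf K) < \<delta>
        \<Longrightarrow> (\<Sum>K\<in>D. \<bar>g (Sup K) - g (Inf K)\<bar>) < e / 2"
      using absolutely_continuous_on_division[OF g] by blast
    have "N \<in> sets lebesgue" using negligible_imp_sets[OF N] .
    then obtain V where V: "open V" "N \<subseteq> V" "V - N \<in> lmeasurable" "emeasure lebesgue (V - N) < ennreal \<delta>"
      using sets_lebesgue_outer_open[of N \<delta>] \<open>\<delta> > 0\<close> by blast
    have V_lm: "V \<in> lmeasurable" and V_meas: "measure lebesgue V < \<delta>"
    proof -
      have Veq: "V = N \<union> (V - N)" using V(2) by auto
      show "V \<in> lmeasurable"
        by (subst Veq) (intro fmeasurable.Un V(3) negligible_imp_measurable[OF N])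
      have "measure lebesgue (V - N) = measure lebesgue V"
        using measure_Diff_null_set[of V lebesgue N] N V(1)
        by (simp add: negligible_iff_null_sets)
      moreover have "measure lebesgue (V - N) < \<delta>"
        using V(4) V(3) \<open>\<delta> > 0\<close> by (simp add: emeasure_eq_measure2 ennreal_less_iff)
      ultimately show "measure lebesgue V < \<delta>" by simp
    qed
    \<comment> \<open>The errors at good tags sum to at most \<open>e1 * (b - a)\<close>, which is
      at most \<open>e / 2\<close>; the 1 admits \<open>a = b\<close>.\<close>
    define e1 where "e1 = e / (2 * (b - a + 1))"
    have "e1 > 0" using \<open>e > 0\<close> \<open>a \<le> b\<close> by (simp add: e1_def)
    have "\<exists>d>0. (x \<in> N \<longrightarrow> ball x d \<subseteq> V) \<and>
        (x \<in> {a..b} - N \<longrightarrow> (\<forall>y\<in>{a..b}. \<bar>y - x\<bar> < d \<longrightarrow> \<bar>g y - g x - (y - x) * g' x\<bar> \<le> e1 * \<bar>y - x\<bar>))"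
      for x
    proof (cases "x \<in> {a..b} - N")
      case True
      from der[OF True] have "(g has_derivative (*) (g' x)) (at x within {a..b})"
        by (simp add: has_field_derivative_def)
      then obtain d where "d > 0" "\<forall>y\<in>{a..b}. \<bar>y - x\<bar> < d \<longrightarrow> \<bar>g y - g x - g' x * (y - x)\<bar> \<le> e1 * \<bar>y - x\<bar>"
        unfolding has_derivative_within_alt real_norm_def using \<open>e1 > 0\<close> by blast
      then show ?thesis using True by (intro exI[of _ d]) (auto simp: mult.commute)
    next
      case False
      have "\<exists>d>0. x \<in> N \<longrightarrow> ball x d \<subseteq> V"
        using V(1,2) open_contains_ball by (cases "x \<in> N") (auto intro: exI[of _ "1::real"])
      then show ?thesis using False by auto
    qed
    then obtain d where d: "\<And>x. d x > 0" "\<And>x. x \<in> N \<Longrightarrow> ball x (d x) \<subseteq> V"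
      "\<And>x y. x \<in> {a..b} - N \<Longrightarrow> y \<in> {a..b} \<Longrightarrow> \<bar>y - x\<bar> < d x
        \<Longrightarrow> \<bar>g y - g x - (y - x) * g' x\<bar> \<le> e1 * \<bar>y - x\<bar>"
      by metis
    show "\<exists>\<gamma>. gauge \<gamma> \<and> (\<forall>\<D>. \<D> tagged_division_of {a..b} \<and> \<gamma> fine \<D> \<longrightarrow>
        norm ((\<Sum>(x, k)\<in>\<D>. measure lborel k *\<^sub>R h x) - (g b - g a)) < e)"
    proof (intro exI[of _ "\<lambda>x. ball x (d x)"] conjI allI impI)
      show "gauge (\<lambda>x. ball x (d x))" using d(1) by (simp add: gauge_ball_dependent)
      fix p assume "p tagged_division_of {a..b} \<and> (\<lambda>x. ball x (d x)) fine p"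
      then have p: "p tagged_division_of {a..b}" and fine: "(\<lambda>x. ball x (d x)) fine p" by auto
      have finp: "finite p" using p by auto
      have tag: "\<exists>u v. u \<le> v \<and> K = {u..v} \<and> Inf K = u \<and> Sup K = v \<and> a \<le> u \<and> v \<le> b \<and> u \<le> x \<and> x \<le> v
          \<and> K \<subseteq> ball x (d x)"
        if xK: "(x, K) \<in> p" for x K
      proof -
        obtain u v where uv: "K = cbox u v" using tagged_division_ofD(4)[OF p xK] by blast
        have x: "x \<in> K" using tagged_division_ofD(2)[OF p xK] .
        then have "u \<le> v" using uv by auto
        moreover have "K \<subseteq> {a..b}" using tagged_division_ofD(3)[OF p xK] .
        moreover have "K \<subseteq> ball x (d x)" using fineD[OF fine xK] .
        ultimately show ?thesis using uv x by (intro exI[of _ u] exI[of _ v]) auto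
      qed
      define pN where "pN = {(x, K) \<in> p. x \<in> N}"
      define pM where "pM = {(x, K) \<in> p. x \<notin> N}"
      have split: "p = pM \<union> pN" "pM \<inter> pN = {}" "finite pN" "finite pM"
        using finp finite_subset[of pN p] finite_subset[of pM p] by (auto simp: pN_def pM_def)
      have tele: "(\<Sum>(x, K)\<in>p. h' (Sup K) - h' (Inf K)) = h' b - h' a" for h' :: "real \<Rightarrow> real"
        using additive_tagged_division_1[OF \<open>a \<le> b\<close> p] .
      let ?t = "\<lambda>(x, K). measure lborel K *\<^sub>R h x - (g (Sup K) - g (Inf K))"
      have M: "\<bar>sum ?t pM\<bar> \<le> e1 * (b - a)"
      proof -
        have "\<bar>sum ?t pM\<bar> \<le> (\<Sum>(x, K)\<in>pM. e1 * (Sup K - Inf K))"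
        proof (rule order_trans[OF sum_abs], rule sum_mono, clarify)
          fix x K assume "(x, K) \<in> pM"
          then have xK: "(x, K) \<in> p" "x \<notin> N" by (auto simp: pM_def)
          obtain u v where uv: "u \<le> v" "K = {u..v}" "Inf K = u" "Sup K = v"
            "a \<le> u" "v \<le> b" "u \<le> x" "x \<le> v" "K \<subseteq> ball x (d x)"
            using tag[OF xK(1)] by blast
          then have "u \<in> K" "v \<in> K" by auto
          then have "u \<in> ball x (d x)" "v \<in> ball x (d x)" using uv(9) by blast+
          then have uvd: "\<bar>u - x\<bar> < d x" "\<bar>v - x\<bar> < d x" by (auto simp: dist_real_def)
          \<comment> \<open>Both endpoints are compared with the tag. As the tag lies between them,
            the two error bounds add up to exactly \<open>e1 * (v - u)\<close>.\<close>
          have "\<bar>g u - g x - (u - x) * g' x\<bar> \<le> e1 * (x - u)"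
            using d(3)[of x u] uv uvd xK by auto
          moreover have "\<bar>g v - g x - (v - x) * g' x\<bar> \<le> e1 * (v - x)"
            using d(3)[of x v] uv uvd xK by auto
          moreover have "(v - u) * g' x = (v - x) * g' x - (u - x) * g' x" by (simp add: algebra_simps)
          moreover have "e1 * (v - u) = e1 * (x - u) + e1 * (v - x)" by (simp add: algebra_simps)
          ultimately have "\<bar>(v - u) * g' x - (g v - g u)\<bar> \<le> e1 * (v - u)" by linarith
          then show "\<bar>measure lborel K *\<^sub>R h x - (g (Sup K) - g (Inf K))\<bar> \<le> e1 * (Sup K - Inf K)"
            using uv xK(2) by (simp add: h_def)
        qed
        also have "\<dots> \<le> (\<Sum>(x, K)\<in>p. e1 * (Sup K - Inf K))"
        proof (rule sum_mono2[OF finp])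
          show "pM \<subseteq> p" by (auto simp: pM_def)
          show "0 \<le> (case y of (x, K) \<Rightarrow> e1 * (Sup K - Inf K))" if y: "y \<in> p - pM" for y
          proof -
            obtain x K where "y = (x, K)" "(x, K) \<in> p" using y by (cases y) auto
            then show ?thesis using tag \<open>e1 > 0\<close> by fastforce
          qed
        qed
        also have "\<dots> = e1 * (b - a)"
          using tele[of "\<lambda>x. e1 * x"] by (simp add: right_diff_distrib)
        finally show ?thesis .
      qed
      have "\<bar>sum ?t pN\<bar> < e / 2"
      proof -
        have part: "pN tagged_division_of (\<Union>(snd ` pN))"
        proof (rule tagged_partial_division_of_Union_self)
          show "pN tagged_partial_division_of {a..b}"
            using p tagged_partial_division_subset[of p "{a..b}" pN]
            by (auto simp: tagged_division_of_def pN_def)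
        qed
        have div: "snd ` pN division_of (\<Union>(snd ` pN))"
          by (rule division_of_tagged_division[OF part])
        \<comment> \<open>Different tags may carry the same degenerate interval, so passing from
          pairs to intervals needs a function that is 0 on intervals with empty interior. The
          explicit 0 serves the empty set, where \<open>Sup\<close> and \<open>Inf\<close> are
          unspecified.\<close>
        define \<nu> where "\<nu> K = (if K = {} then 0 else \<bar>g (Sup K) - g (Inf K)\<bar>)" for K
        have ne: "K \<noteq> {}" if "(x, K) \<in> pN" for x K
          using tagged_division_ofD(2)[OF part that] by blast
        have "\<bar>sum ?t pN\<bar> \<le> (\<Sum>(x, K)\<in>pN. \<bar>g (Sup K) - g (Inf K)\<bar>)"
          by (rule order_trans[OF sum_abs], rule sum_mono) (auto simp: pN_def h_def)
        also have "\<dots> = (\<Sum>(x, K)\<in>pN. \<nu> K)"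
          using ne by (intro sum.cong) (auto simp: \<nu>_def)
        also have "\<dots> = sum \<nu> (snd ` pN)"
        proof (rule sum.over_tagged_division_lemma[OF part])
          fix u v :: real assume "box u v = {}"
          then have "v \<le> u" by (simp add: box_real)
          then show "\<nu> (cbox u v) = 0"
            by (cases "u = v") (auto simp: \<nu>_def)
        qed
        also have "\<dots> = (\<Sum>K\<in>snd ` pN. \<bar>g (Sup K) - g (Inf K)\<bar>)"
          using ne by (intro sum.cong) (auto simp: \<nu>_def)
        also have "\<dots> < e / 2"
        proof (rule ac[OF div])
          show "\<Union>(snd ` pN) \<subseteq> {a..b}"
            unfolding UN_subset_iff
          proof
            fix y assume "y \<in> pN"
            then have "(fst y, snd y) \<in> p" by (auto simp: pN_def)
            then show "snd y \<subseteq> {a..b}" by (rule tagged_division_ofD(3)[OF p])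
          qed
          have "K \<subseteq> V" if K: "(x, K) \<in> pN" for x K
          proof -
            have "(x, K) \<in> p" "x \<in> N" using K by (auto simp: pN_def)
            then show ?thesis using fineD[OF fine] d(2)[of x] by blast
          qed
          then have "\<Union>(snd ` pN) \<subseteq> V" by force
          then have "measure lebesgue (\<Union>(snd ` pN)) \<le> measure lebesgue V"
            using V_lm lmeasurable_division[OF div] by (intro measure_mono_fmeasurable) auto
          then show "(\<Sum>K\<in>snd ` pN. Sup K - Inf K) < \<delta>"
            using V_meas measure_division_of_real[OF div] by simp
        qed
        finally show ?thesis .
      qed
      moreover have "e1 * (b - a) \<le> e / 2"
        using \<open>a \<le> b\<close> \<open>e > 0\<close> by (simp add: e1_def field_simps)
      moreover have "(\<Sum>(x, k)\<in>p. measure lborel k *\<^sub>R h x) - (g b - g a) = sum ?t pM + sum ?t pN"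
        unfolding tele[of g, symmetric] sum_subtractf[symmetric] split(1)
        using split by (subst sum.union_disjoint) (auto simp: case_prod_unfold sum_subtractf)
      ultimately show "norm ((\<Sum>(x, k)\<in>p. measure lborel k *\<^sub>R h x) - (g b - g a)) < e"
        using M unfolding real_norm_def by linarith
    qed
  qed
  then show ?thesis
    using has_integral_spike[OF N, of "{a..b}" g' h] by (simp add: h_def)
qed

section \<open>The Peano kernel representation\<close>

lemma real_mean_value_bound:
  fixes f :: "real \<Rightarrow> real"
  assumes der: "\<And>t. t \<in> {c..d} \<Longrightarrow> (f has_real_derivative f' t) (at t within {c..d})"
    and bound: "\<And>t. t \<in> {c..d} \<Longrightarrow> \<bar>f' t\<bar> \<le> B"
    and "u \<in> {c..d}" "v \<in> {c..d}"
  shows "\<bar>f v - f u\<bar> \<le> B * \<bar>v - u\<bar>"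
  using field_differentiable_bound[of "{c..d}" f f' B v u] assms by (auto simp: real_norm_def)

text \<open>Two integrations by parts at once: the integrand is the derivative almost everywhere of the
  absolutely continuous function \<open>(t - z)\<^sup>2 / 2 * f' t - (t - z) * f t + integral {c..t} f\<close>.\<close>
lemma has_integral_quadratic_kernel:
  fixes f f' :: "real \<Rightarrow> real"
  assumes "c \<le> d"
    and f: "\<And>t. t \<in> {c..d} \<Longrightarrow> (f has_real_derivative f' t) (at t within {c..d})"
    and ac: "absolutely_continuous_on {c..d} f'"
  shows "((\<lambda>t. (t - z)\<^sup>2 / 2 * deriv f' t) has_integral
     ((d - z)\<^sup>2 / 2 * f' d - (d - z) * f d) - ((c - z)\<^sup>2 / 2 * f' c - (c - z) * f c)
       + integral {c..d} f) {c..d}"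
proof -
  define F where "F t = integral {c..t} f" for t
  \<comment> \<open>Here \<open>f\<close> cancels in the derivative, leaving
    \<open>- (t - z) * f' t\<close>, which exists everywhere and is bounded; hence
    \<open>\<psi>\<close> is Lipschitz.\<close>
  define \<psi> where "\<psi> t = F t - (t - z) * f t" for t
  define \<Phi> where "\<Phi> t = (t - z)\<^sup>2 / 2 * f' t + \<psi> t" for t
  have contf: "continuous_on {c..d} f"
    using f by (rule DERIV_continuous_on)
  have F: "(F has_real_derivative f t) (at t within {c..d})" if "t \<in> {c..d}" for t
    unfolding F_def using contf that by (rule integral_has_real_derivative)
  have \<psi>: "(\<psi> has_real_derivative - (t - z) * f' t) (at t within {c..d})" if "t \<in> {c..d}" for t
    unfolding \<psi>_def using F[OF that] f[OF that]
    by (auto intro!: derivative_eq_intros simp: algebra_simps)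
  have contf': "continuous_on {c..d} f'" by (rule absolutely_continuous_on_imp_continuous_on[OF ac])
  obtain M where M: "M \<ge> 0" "\<And>t. t \<in> {c..d} \<Longrightarrow> \<bar>f' t\<bar> \<le> M"
  proof -
    have "bounded (f' ` {c..d})"
      using contf' by (intro compact_imp_bounded compact_continuous_image) auto
    then obtain M where "\<forall>t\<in>{c..d}. \<bar>f' t\<bar> \<le> M"
      unfolding bounded_iff by auto
    then show ?thesis using that[of "max M 0"] by fastforce
  qed
  define R where "R = \<bar>c\<bar> + \<bar>d\<bar> + \<bar>z\<bar>"
  have R: "R \<ge> 0" "\<And>t. t \<in> {c..d} \<Longrightarrow> \<bar>t - z\<bar> \<le> R" by (auto simp: R_def)
  have ac\<Phi>: "absolutely_continuous_on {c..d} \<Phi>"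
  proof (rule absolutely_continuous_on_dominated[OF ac, of "R\<^sup>2 / 2" "R * M + M * R"])
    show "0 \<le> R\<^sup>2 / 2" "0 \<le> R * M + M * R" using M R by auto
    fix u v :: real assume "u \<le> v" "{u..v} \<subseteq> {c..d}"
    then have uv: "u \<in> {c..d}" "v \<in> {c..d}" by auto
    let ?\<phi> = "\<lambda>t. (t - z)\<^sup>2 / 2"
    have 1: "\<bar>\<psi> v - \<psi> u\<bar> \<le> R * M * (v - u)"
    proof -
      have "\<bar>- (t - z) * f' t\<bar> \<le> R * M" if "t \<in> {c..d}" for t
        using mult_mono[OF R(2) M(2) R(1), OF that that]
        unfolding abs_mult abs_minus_cancel by simp
      from real_mean_value_bound[OF \<psi> this uv] show ?thesis using \<open>u \<le> v\<close> by simp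
    qed
    have 2: "\<bar>?\<phi> v - ?\<phi> u\<bar> \<le> R * (v - u)"
    proof -
      have "(?\<phi> has_real_derivative (t - z)) (at t within {c..d})" for t
        by (auto intro!: derivative_eq_intros)
      from real_mean_value_bound[OF this R(2) uv] show ?thesis using \<open>u \<le> v\<close> by simp
    qed
    have 3: "\<bar>?\<phi> v\<bar> \<le> R\<^sup>2 / 2"
      using power_mono[OF R(2)[OF uv(2)] abs_ge_zero, of 2] by simp
    \<comment> \<open>The discrete product rule: only the first summand involves an increment of
      \<open>f'\<close>, and the other two are bounded by a multiple of
      \<open>v - u\<close>.\<close>
    have "\<Phi> v - \<Phi> u = ?\<phi> v * (f' v - f' u) + f' u * (?\<phi> v - ?\<phi> u) + (\<psi> v - \<psi> u)"
      unfolding \<Phi>_def by (simp add: algebra_simps diff_divide_distrib)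
    moreover have "\<bar>X + Y + Z\<bar> \<le> \<bar>X\<bar> + \<bar>Y\<bar> + \<bar>Z\<bar>" for X Y Z :: real by linarith
    ultimately have "\<bar>\<Phi> v - \<Phi> u\<bar> \<le> \<bar>?\<phi> v\<bar> * \<bar>f' v - f' u\<bar> + \<bar>f' u\<bar> * \<bar>?\<phi> v - ?\<phi> u\<bar> + \<bar>\<psi> v - \<psi> u\<bar>"
      unfolding abs_mult[symmetric] by (simp only:)
    also have "\<dots> \<le> R\<^sup>2 / 2 * \<bar>f' v - f' u\<bar> + M * (R * (v - u)) + R * M * (v - u)"
      using 1 2 3 M uv by (intro add_mono mult_mono) auto
    finally show "\<bar>\<Phi> v - \<Phi> u\<bar> \<le> R\<^sup>2 / 2 * \<bar>f' v - f' u\<bar> + (R * M + M * R) * (v - u)"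
      by (simp add: algebra_simps)
  qed
  obtain N where N: "negligible N"
    "\<And>t. t \<in> {c<..<d} - N \<Longrightarrow> (f' has_real_derivative deriv f' t) (at t)"
    using absolutely_continuous_on_differentiable_ae[OF ac] by blast
  have "((\<lambda>t. (t - z)\<^sup>2 / 2 * deriv f' t) has_integral (\<Phi> d - \<Phi> c)) {c..d}"
  proof (rule absolutely_continuous_on_has_integral_deriv[OF ac\<Phi> \<open>c \<le> d\<close>])
    \<comment> \<open>The endpoints join the exceptional set, since almost everywhere
      differentiability was obtained on the open interval.\<close>
    show "negligible (N \<union> {c, d})" using N(1) by (simp add: negligible_Un)
    fix t assume t: "t \<in> {c..d} - (N \<union> {c, d})"
    then have "(f' has_real_derivative deriv f' t) (at t within {c..d})"
      by (intro has_field_derivative_at_within[OF N(2)]) auto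
    \<comment> \<open>The term \<open>(t - z) * f' t\<close> of the product rule is cancelled by the
      derivative of \<open>\<psi>\<close>.\<close>
    then show "(\<Phi> has_real_derivative (t - z)\<^sup>2 / 2 * deriv f' t) (at t within {c..d})"
      unfolding \<Phi>_def using \<psi>[of t] t
      by (auto intro!: derivative_eq_intros simp: algebra_simps add_divide_distrib diff_divide_distrib)
  qed
  moreover have "\<Phi> d - \<Phi> c = ((d - z)\<^sup>2 / 2 * f' d - (d - z) * f d)
      - ((c - z)\<^sup>2 / 2 * f' c - (c - z) * f c) + integral {c..d} f"
    by (simp add: \<Phi>_def \<psi>_def F_def)
  ultimately show ?thesis by simp
qed

lemma integral_mean_eq_integral:
  assumes "continuous_on {c..d} f"
  shows "integral_mean f c d = integral {c..d} f / (d - c)"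
  using lebesgue_integral_eq_integral[OF continuous_imp_integrable_real[OF assms]]
  by (simp add: integral_mean_def)

text \<open>Each branch is a constant times the quadratic of
  \<open>has_integral_quadratic_kernel\<close>, taken with \<open>z = a\<close> or
  \<open>z = b\<close>.\<close>

definition ostrowski_kernel :: "real \<Rightarrow> real \<Rightarrow> real \<Rightarrow> real \<Rightarrow> real \<Rightarrow> real \<Rightarrow> real" where
  "ostrowski_kernel \<alpha> \<beta> a x b t =
     (if t \<le> x then \<alpha> / (x - a) * ((t - a)\<^sup>2 / 2) else \<beta> / (b - x) * ((b - t)\<^sup>2 / 2))"

lemma has_integral_ostrowski_kernel_deriv:
  fixes f f' :: "real \<Rightarrow> real"
  assumes "a < x" "x < b" "\<alpha> + \<beta> \<noteq> 0"
    and f: "\<And>t. t \<in> {a..b} \<Longrightarrow> (f has_real_derivative f' t) (at t within {a..b})"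
    and ac: "absolutely_continuous_on {a..b} f'"
  shows "((\<lambda>t. ostrowski_kernel \<alpha> \<beta> a x b t * deriv f' t) has_integral
    (\<alpha> + \<beta>) * (1 / (2 * (\<alpha> + \<beta>)) * (\<alpha> * (x - a) - \<beta> * (b - x)) * f' x - f x
             + 1 / (\<alpha> + \<beta>) * (\<alpha> * integral_mean f a x + \<beta> * integral_mean f x b))) {a..b}"
proof -
  have sub: "{a..x} \<subseteq> {a..b}" "{x..b} \<subseteq> {a..b}" using assms by auto
  have contf: "continuous_on {a..b} f" using f by (rule DERIV_continuous_on)
  note mean = integral_mean_eq_integral[OF continuous_on_subset[OF contf sub(1)]]
    integral_mean_eq_integral[OF continuous_on_subset[OF contf sub(2)]]
  have "((\<lambda>t. (t - a)\<^sup>2 / 2 * deriv f' t) has_integral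
      (x - a)\<^sup>2 / 2 * f' x - (x - a) * f x + integral {a..x} f) {a..x}"
    using has_integral_quadratic_kernel[of a x f f' a] assms(1)
      DERIV_subset[OF f sub(1)] sub(1) absolutely_continuous_on_subset[OF ac sub(1)] by auto
  from has_integral_mult_right[OF this, of "\<alpha> / (x - a)"]
  have left: "((\<lambda>t. ostrowski_kernel \<alpha> \<beta> a x b t * deriv f' t) has_integral
     \<alpha> / (x - a) * ((x - a)\<^sup>2 / 2 * f' x - (x - a) * f x + integral {a..x} f)) {a..x}"
    by (rule has_integral_eq[rotated]) (auto simp: ostrowski_kernel_def)
  have "((\<lambda>t. (t - b)\<^sup>2 / 2 * deriv f' t) has_integral
      - ((b - x)\<^sup>2 / 2 * f' x + (b - x) * f x) + integral {x..b} f) {x..b}"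
    using has_integral_quadratic_kernel[of x b f f' b] assms(2)
      DERIV_subset[OF f sub(2)] sub(2) absolutely_continuous_on_subset[OF ac sub(2)]
    by (auto simp: power2_commute[of x b] algebra_simps)
  from has_integral_mult_right[OF this, of "\<beta> / (b - x)"]
  have right: "((\<lambda>t. ostrowski_kernel \<alpha> \<beta> a x b t * deriv f' t) has_integral
     \<beta> / (b - x) * (- ((b - x)\<^sup>2 / 2 * f' x + (b - x) * f x) + integral {x..b} f)) {x..b}"
    \<comment> \<open>At \<open>x\<close> itself the kernel takes its left branch, so the right
      integrand differs from it in that one point.\<close>
    by (rule has_integral_spike_finite[of "{x}", rotated 2])
       (auto simp: ostrowski_kernel_def power2_commute[of _ b])
  have "\<alpha> / (x - a) * ((x - a)\<^sup>2 / 2 * f' x - (x - a) * f x + integral {a..x} f)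
      + \<beta> / (b - x) * (- ((b - x)\<^sup>2 / 2 * f' x + (b - x) * f x) + integral {x..b} f)
    = (\<alpha> + \<beta>) * (1 / (2 * (\<alpha> + \<beta>)) * (\<alpha> * (x - a) - \<beta> * (b - x)) * f' x - f x
             + 1 / (\<alpha> + \<beta>) * (\<alpha> * integral_mean f a x + \<beta> * integral_mean f x b))"
  proof -
    define A where "A = x - a"
    define B where "B = b - x"
    have "A \<noteq> 0" "B \<noteq> 0" using assms by (auto simp: A_def B_def)
    have 1: "s * (1 / (2 * s) * Y - y + 1 / s * Z) = Y / 2 - s * y + Z" if "s \<noteq> 0" for s y Y Z :: real
      using that by (simp add: field_simps)
    have 2: "C / L * (L\<^sup>2 / 2 * w - L * y + J) = C * L / 2 * w - C * y + C * (J / L)"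
      if "L \<noteq> 0" for C L J w y :: real
      using that by (simp add: field_simps power2_eq_square)
    \<comment> \<open>Moving the sign onto \<open>f' x\<close> makes the right half an instance of
      the same identity as the left half.\<close>
    have 3: "\<beta> / B * (- (B\<^sup>2 / 2 * f' x + B * f x) + integral {x..b} f)
        = \<beta> / B * (B\<^sup>2 / 2 * (- f' x) - B * f x + integral {x..b} f)" by simp
    have 4: "1 / (2 * (\<alpha> + \<beta>)) * (\<alpha> * A - \<beta> * B) * f' x
        = 1 / (2 * (\<alpha> + \<beta>)) * ((\<alpha> * A - \<beta> * B) * f' x)" by (rule mult.assoc)
    show ?thesis
      unfolding mean A_def[symmetric] B_def[symmetric]
      unfolding 3 4 1[OF assms(3)] 2[OF \<open>A \<noteq> 0\<close>] 2[OF \<open>B \<noteq> 0\<close>]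
      by (simp add: algebra_simps diff_divide_distrib)
  qed
  then show ?thesis
    using has_integral_combine[OF _ _ left right] assms by simp
qed

section \<open>Norm estimates\<close>

text \<open>Young's inequality is used twice: pointwise for the integrability of the product, and
  for the functions divided by their norms, where the right side integrates to
  \<open>1 / p + 1 / q = 1\<close>.\<close>

lemma Holder_inequality_powr:
  fixes f g :: "'a \<Rightarrow> real"
  assumes pq: "p > 1" "q > 1" "1 / p + 1 / q = 1"
    and [measurable]: "f \<in> borel_measurable M" "g \<in> borel_measurable M"
    and f: "integrable M (\<lambda>t. \<bar>f t\<bar> powr p)" and g: "integrable M (\<lambda>t. \<bar>g t\<bar> powr q)"
  shows "integrable M (\<lambda>t. f t * g t)"
    and "(LINT t|M. \<bar>f t * g t\<bar>)
      \<le> (LINT t|M. \<bar>f t\<bar> powr p) powr (1 / p) * (LINT t|M. \<bar>g t\<bar> powr q) powr (1 / q)"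
proof -
  show int: "integrable M (\<lambda>t. f t * g t)"
  proof (rule Bochner_Integration.integrable_bound)
    show "integrable M (\<lambda>t. \<bar>f t\<bar> powr p / p + \<bar>g t\<bar> powr q / q)" using f g by simp
    show "AE t in M. norm (f t * g t) \<le> norm (\<bar>f t\<bar> powr p / p + \<bar>g t\<bar> powr q / q)"
    proof (rule AE_I2)
      fix t
      have "\<bar>f t\<bar> * \<bar>g t\<bar> \<le> \<bar>f t\<bar> powr p / p + \<bar>g t\<bar> powr q / q"
        using pq by (intro Youngs_inequality) auto
      then show "norm (f t * g t) \<le> norm (\<bar>f t\<bar> powr p / p + \<bar>g t\<bar> powr q / q)"
        by (simp add: abs_mult)
    qed
  qed simp
  define A where "A = (LINT t|M. \<bar>f t\<bar> powr p)"
  define B where "B = (LINT t|M. \<bar>g t\<bar> powr q)"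
  have AB0: "A \<ge> 0" "B \<ge> 0" unfolding A_def B_def by simp_all
  have "(LINT t|M. \<bar>f t * g t\<bar>) \<le> A powr (1 / p) * B powr (1 / q)"
  \<comment> \<open>A zero norm cannot be normalised, but then one factor, and with it the product,
    vanishes almost everywhere.\<close>
  proof (cases "A = 0 \<or> B = 0")
    case True
    have "AE t in M. \<bar>f t\<bar> powr p = 0" if "A = 0"
      using integral_nonneg_eq_0_iff_AE[OF f] that unfolding A_def by simp
    moreover have "AE t in M. \<bar>g t\<bar> powr q = 0" if "B = 0"
      using integral_nonneg_eq_0_iff_AE[OF g] that unfolding B_def by simp
    ultimately have "AE t in M. \<bar>f t * g t\<bar> = 0"
      using True by (auto elim!: eventually_mono)
    then have "(LINT t|M. \<bar>f t * g t\<bar>) = 0" by (rule integral_eq_zero_AE)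
    then show ?thesis by simp
  next
    case False
    then have AB: "A > 0" "B > 0" using AB0 by auto
    let ?c = "A powr (1 / p)" and ?d = "B powr (1 / q)"
    have cd: "?c > 0" "?d > 0" using AB by auto
    have pw: "\<bar>f t * g t\<bar> / (?c * ?d) \<le> \<bar>f t\<bar> powr p / (p * A) + \<bar>g t\<bar> powr q / (q * B)" for t
    proof -
      have "(\<bar>f t\<bar> / ?c) * (\<bar>g t\<bar> / ?d) \<le> (\<bar>f t\<bar> / ?c) powr p / p + (\<bar>g t\<bar> / ?d) powr q / q"
        using pq cd by (intro Youngs_inequality) auto
      moreover have "(\<bar>f t\<bar> / ?c) powr p = \<bar>f t\<bar> powr p / A" "(\<bar>g t\<bar> / ?d) powr q = \<bar>g t\<bar> powr q / B"
        using AB pq by (simp_all add: powr_divide powr_powr)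
      ultimately show ?thesis by (simp add: abs_mult field_simps)
    qed
    have "(LINT t|M. \<bar>f t * g t\<bar> / (?c * ?d)) \<le> (LINT t|M. \<bar>f t\<bar> powr p / (p * A) + \<bar>g t\<bar> powr q / (q * B))"
      using int f g by (intro integral_mono pw) auto
    also have "\<dots> = A / (p * A) + B / (q * B)"
      using f g by (simp add: A_def B_def)
    also have "\<dots> = 1" using AB pq by simp
    finally have "(LINT t|M. \<bar>f t * g t\<bar>) / (?c * ?d) \<le> 1" by simp
    then show ?thesis using cd by (simp add: divide_le_eq)
  qed
  then show "(LINT t|M. \<bar>f t * g t\<bar>)
      \<le> (LINT t|M. \<bar>f t\<bar> powr p) powr (1 / p) * (LINT t|M. \<bar>g t\<bar> powr q) powr (1 / q)"
    by (simp add: A_def B_def)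
qed

section \<open>Integrals of powers of the kernel, and its supremum\<close>

lemma quadratic_powr:
  fixes C s q :: real
  assumes "C \<ge> 0" "s \<ge> 0" "q > 0"
  shows "(C * (s\<^sup>2 / 2)) powr q = (C / 2) powr q * s powr (2 * q)"
proof (cases "s = 0")
  case False
  then have "(s\<^sup>2) powr q = s powr (2 * q)"
    using assms by (simp add: powr_powr flip: powr_numeral)
  moreover have "C * (s\<^sup>2 / 2) = (C / 2) * s\<^sup>2" by simp
  ultimately show ?thesis using assms by (metis powr_mult)
qed (use assms in simp)

text \<open>The derivative rule for \<open>powr\<close> wants a positive base, which fails at one
  endpoint. The form of the fundamental theorem that differentiates only in the interior avoids
  this.\<close>

lemma has_integral_powr_base_point:
  fixes c d r :: real
  assumes "c \<le> d" "r > 0"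
  shows "((\<lambda>t. (t - c) powr r) has_integral (d - c) powr (r + 1) / (r + 1)) {c..d}"
    and "((\<lambda>t. (d - t) powr r) has_integral (d - c) powr (r + 1) / (r + 1)) {c..d}"
proof -
  have "((\<lambda>t. (t - c) powr r) has_integral
      (d - c) powr (r + 1) / (r + 1) - (c - c) powr (r + 1) / (r + 1)) {c..d}"
  proof (rule fundamental_theorem_of_calculus_interior[OF assms(1)])
    show "continuous_on {c..d} (\<lambda>t. (t - c) powr (r + 1) / (r + 1))"
      using assms by (intro continuous_intros continuous_on_powr') auto
    fix t assume "t \<in> {c<..<d}"
    then show "((\<lambda>t. (t - c) powr (r + 1) / (r + 1)) has_vector_derivative (t - c) powr r) (at t)"
      unfolding has_real_derivative_iff_has_vector_derivative[symmetric]
      using assms by (auto intro!: derivative_eq_intros)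
  qed
  then show "((\<lambda>t. (t - c) powr r) has_integral (d - c) powr (r + 1) / (r + 1)) {c..d}"
    using assms by simp
  have "((\<lambda>t. (d - t) powr r) has_integral
      - ((d - d) powr (r + 1) / (r + 1)) - - ((d - c) powr (r + 1) / (r + 1))) {c..d}"
  proof (rule fundamental_theorem_of_calculus_interior[OF assms(1)])
    show "continuous_on {c..d} (\<lambda>t. - ((d - t) powr (r + 1) / (r + 1)))"
      using assms by (intro continuous_intros continuous_on_powr') auto
    fix t assume "t \<in> {c<..<d}"
    then show "((\<lambda>t. - ((d - t) powr (r + 1) / (r + 1))) has_vector_derivative (d - t) powr r) (at t)"
      unfolding has_real_derivative_iff_has_vector_derivative[symmetric]
      using assms by (auto intro!: derivative_eq_intros)
  qed
  then show "((\<lambda>t. (d - t) powr r) has_integral (d - c) powr (r + 1) / (r + 1)) {c..d}"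
    using assms by simp
qed

text \<open>Integrating the power \<open>2 * q\<close> gives the exponent \<open>2 * q + 1\<close>
  of the length \<open>L\<close> and the divisor \<open>2 * q + 1\<close>; the factor
  \<open>(C / L / 2) powr q\<close> lowers the exponent to \<open>q + 1\<close> and supplies
  \<open>2 powr q\<close>.\<close>

lemma has_integral_ostrowski_kernel_powr:
  fixes q :: real
  assumes "a < x" "x < b" "\<alpha> \<ge> 0" "\<beta> \<ge> 0" "q > 0"
  shows "((\<lambda>t. ostrowski_kernel \<alpha> \<beta> a x b t powr q) has_integral
     (\<alpha> powr q * (x - a) powr (q + 1) + \<beta> powr q * (b - x) powr (q + 1)) / (2 powr q * (2 * q + 1))) {a..b}"
proof -
  have const: "(C / L / 2) powr q * (L powr (2 * q + 1) / (2 * q + 1))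
      = C powr q * L powr (q + 1) / (2 powr q * (2 * q + 1))" if "C \<ge> 0" "L > 0" for C L :: real
  proof -
    have "L powr (2 * q + 1) = L powr q * L powr (q + 1)"
      by (simp flip: powr_add add: algebra_simps)
    moreover have "(C / L / 2) powr q = C powr q / L powr q / 2 powr q"
      using that by (simp add: powr_divide powr_mult)
    ultimately show ?thesis using that by simp
  qed
  have "((\<lambda>t. (\<alpha> / (x - a) / 2) powr q * (t - a) powr (2 * q)) has_integral
     \<alpha> powr q * (x - a) powr (q + 1) / (2 powr q * (2 * q + 1))) {a..x}"
    using has_integral_mult_right[OF has_integral_powr_base_point(1)[of a x "2 * q"],
        of "(\<alpha> / (x - a) / 2) powr q"] const[of \<alpha> "x - a"] assms by simp
  then have left: "((\<lambda>t. ostrowski_kernel \<alpha> \<beta> a x b t powr q) has_integral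
     \<alpha> powr q * (x - a) powr (q + 1) / (2 powr q * (2 * q + 1))) {a..x}"
  proof (rule has_integral_eq[rotated])
    fix t assume "t \<in> {a..x}"
    then show "(\<alpha> / (x - a) / 2) powr q * (t - a) powr (2 * q) = ostrowski_kernel \<alpha> \<beta> a x b t powr q"
      using quadratic_powr[of "\<alpha> / (x - a)" "t - a" q] assms by (simp add: ostrowski_kernel_def)
  qed
  have "((\<lambda>t. (\<beta> / (b - x) / 2) powr q * (b - t) powr (2 * q)) has_integral
     \<beta> powr q * (b - x) powr (q + 1) / (2 powr q * (2 * q + 1))) {x..b}"
    using has_integral_mult_right[OF has_integral_powr_base_point(2)[of x b "2 * q"],
        of "(\<beta> / (b - x) / 2) powr q"] const[of \<beta> "b - x"] assms by simp
  then have right: "((\<lambda>t. ostrowski_kernel \<alpha> \<beta> a x b t powr q) has_integral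
     \<beta> powr q * (b - x) powr (q + 1) / (2 powr q * (2 * q + 1))) {x..b}"
  proof (rule has_integral_spike_finite[of "{x}", rotated 2])
    fix t assume "t \<in> {x..b} - {x}"
    then show "ostrowski_kernel \<alpha> \<beta> a x b t powr q = (\<beta> / (b - x) / 2) powr q * (b - t) powr (2 * q)"
      using quadratic_powr[of "\<beta> / (b - x)" "b - t" q] assms by (simp add: ostrowski_kernel_def)
  qed simp
  show ?thesis
    using has_integral_combine[OF _ _ left right] assms by (simp add: add_divide_distrib)
qed

lemma ostrowski_kernel_nonneg:
  assumes "a < x" "x < b" "\<alpha> \<ge> 0" "\<beta> \<ge> 0"
  shows "0 \<le> ostrowski_kernel \<alpha> \<beta> a x b t"
  using assms by (simp add: ostrowski_kernel_def)

text \<open>On \<open>{a..b}\<close> both branches increase towards \<open>x\<close>, where they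
  reach or approach \<open>\<alpha> * (x - a) / 2\<close> and
  \<open>\<beta> * (b - x) / 2\<close>.\<close>

lemma ostrowski_kernel_le:
  assumes "a < x" "x < b" "\<alpha> \<ge> 0" "\<beta> \<ge> 0" "t \<in> {a..b}"
  shows "ostrowski_kernel \<alpha> \<beta> a x b t \<le> max (\<alpha> * (x - a)) (\<beta> * (b - x)) / 2"
proof -
  have le: "C / L * (s\<^sup>2 / 2) \<le> C * L / 2" if "0 \<le> s" "s \<le> L" "0 < L" "0 \<le> C" for C L s :: real
  proof -
    have "s\<^sup>2 \<le> L\<^sup>2" using that by (intro power_mono) auto
    then have "C / L * (s\<^sup>2 / 2) \<le> C / L * (L\<^sup>2 / 2)"
      using that by (intro mult_left_mono) auto
    then show ?thesis using that by (simp add: power2_eq_square)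
  qed
  show ?thesis
  proof (cases "t \<le> x")
    case True
    then have "ostrowski_kernel \<alpha> \<beta> a x b t \<le> \<alpha> * (x - a) / 2"
      using le[of "t - a" "x - a" \<alpha>] assms by (simp add: ostrowski_kernel_def)
    then show ?thesis by simp
  next
    case False
    then have "ostrowski_kernel \<alpha> \<beta> a x b t \<le> \<beta> * (b - x) / 2"
      using le[of "b - t" "b - x" \<beta>] assms by (simp add: ostrowski_kernel_def)
    then show ?thesis by simp
  qed
qed

lemma borel_measurable_ostrowski_kernel [measurable]:
  "ostrowski_kernel \<alpha> \<beta> a x b \<in> borel_measurable (lebesgue_on S)"
proof -
  have "ostrowski_kernel \<alpha> \<beta> a x b \<in> borel_measurable borel"
    unfolding ostrowski_kernel_def by measurable
  then have "ostrowski_kernel \<alpha> \<beta> a x b \<in> borel_measurable lebesgue"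
    by (intro measurable_completion) simp
  then show ?thesis by (rule measurable_restrict_space1)
qed

section \<open>The three bounds for \<open>\<tau>\<close>, one for each pair of dual
  exponents\<close>

theorem lemma3:
  fixes a b x \<alpha> \<beta> \<tau> :: real and f f' :: "real \<Rightarrow> real"
  assumes "a < x" and "x < b"
    and "\<alpha> \<ge> 0" and "\<beta> \<ge> 0" and "\<not> (\<alpha> = 0 \<and> \<beta> = 0)"
    and "\<And>t. t \<in> {a..b} \<Longrightarrow> (f has_real_derivative f' t) (at t within {a..b})"
    and "absolutely_continuous_on {a..b} f'"
    and "\<tau> = 1 / (2 * (\<alpha> + \<beta>)) * (\<alpha> * (x - a) - \<beta> * (b - x)) * f' x - f x
             + 1 / (\<alpha> + \<beta>) * (\<alpha> * integral_mean f a x + \<beta> * integral_mean f x b)"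
  shows
    "(deriv f' \<in> Linf_space a b \<longrightarrow>
        \<bar>\<tau>\<bar> \<le> (\<alpha> * (x - a)^2 + \<beta> * (b - x)^2) * (Linf_norm a b (deriv f') / (6 * (\<alpha> + \<beta>))))
     \<and>
     (\<forall>p q :: real. p > 1 \<and> 1 / p + 1 / q = 1 \<and> deriv f' \<in> Lp_space p a b \<longrightarrow>
        \<bar>\<tau>\<bar> \<le> 1 / (2 * q + 1) powr (1 / q)
               * (\<alpha> powr q * (x - a) powr (q + 1) + \<beta> powr q * (b - x) powr (q + 1)) powr (1 / q)
               * (Lp_norm p a b (deriv f') / (2 * (\<alpha> + \<beta>))))
     \<and>
     (deriv f' \<in> Lp_space 1 a b \<longrightarrow>
        \<bar>\<tau>\<bar> \<le> (\<alpha> * (x - a) + \<beta> * (b - x) + \<bar>\<alpha> * (x - a) - \<beta> * (b - x)\<bar>)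
               * (Lp_norm 1 a b (deriv f') / (4 * (\<alpha> + \<beta>))))"
proof -
  let ?M = "lebesgue_on {a..b}" and ?k = "deriv f'"
  define K where "K = ostrowski_kernel \<alpha> \<beta> a x b"
  define m where "m = max (\<alpha> * (x - a)) (\<beta> * (b - x)) / 2"
  have pos: "\<alpha> + \<beta> > 0" using assms(3-5) by linarith
  interpret finite_measure ?M by (rule finite_measure_lebesgue_on) simp
  have K0: "0 \<le> K t" for t
    unfolding K_def by (rule ostrowski_kernel_nonneg[OF assms(1-4)])
  have Km: "K t \<le> m" if "t \<in> {a..b}" for t
    unfolding K_def m_def by (rule ostrowski_kernel_le[OF assms(1-4) that])
  have [measurable]: "K \<in> borel_measurable ?M"
    unfolding K_def by measurable
  \<comment> \<open>The value \<open>q = 1\<close> serves the bound by the essential supremum, the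
    dual exponent the bound by the \<open>p\<close>-norm.\<close>
  have K_powr: "integrable ?M (\<lambda>t. K t powr q)" "(LINT t|?M. K t powr q) =
      (\<alpha> powr q * (x - a) powr (q + 1) + \<beta> powr q * (b - x) powr (q + 1)) / (2 powr q * (2 * q + 1))"
    if "q > 0" for q
  proof -
    show int: "integrable ?M (\<lambda>t. K t powr q)"
      using K0 Km that by (intro integrable_const_bound[of _ "m powr q"]) (auto intro!: AE_I2 powr_mono2)
    show "(LINT t|?M. K t powr q) =
      (\<alpha> powr q * (x - a) powr (q + 1) + \<beta> powr q * (b - x) powr (q + 1)) / (2 powr q * (2 * q + 1))"
      using lebesgue_integral_eq_integral[OF int]
        integral_unique[OF has_integral_ostrowski_kernel_powr[OF assms(1-4) that]]
      by (simp add: K_def)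
  qed
  \<comment> \<open>The integrability assumed here identifies the gauge integral of the
    representation with the Lebesgue integral; each case provides it in its own way.\<close>
  have repr: "(\<alpha> + \<beta>) * \<bar>\<tau>\<bar> \<le> (LINT t|?M. \<bar>K t * ?k t\<bar>)" if int: "integrable ?M (\<lambda>t. K t * ?k t)"
  proof -
    have "((\<lambda>t. K t * ?k t) has_integral (\<alpha> + \<beta>) * \<tau>) {a..b}"
      unfolding K_def assms(8) using pos
      by (intro has_integral_ostrowski_kernel_deriv assms(1,2,6,7)) auto
    then have "(LINT t|?M. K t * ?k t) = (\<alpha> + \<beta>) * \<tau>"
      using lebesgue_integral_eq_integral[OF int] by (simp add: integral_unique)
    then have "\<bar>(\<alpha> + \<beta>) * \<tau>\<bar> \<le> (LINT t|?M. \<bar>K t * ?k t\<bar>)"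
      using integral_abs_bound[of ?M "\<lambda>t. K t * ?k t"] by simp
    then show ?thesis using pos by (simp add: abs_mult)
  qed
  have sup_case: "\<bar>\<tau>\<bar> \<le> (\<alpha> * (x - a)^2 + \<beta> * (b - x)^2) * (Linf_norm a b ?k / (6 * (\<alpha> + \<beta>)))"
    if k: "?k \<in> Linf_space a b"
  proof -
    have [measurable]: "?k \<in> borel_measurable ?M" using k by (simp add: Linf_space_def)
    let ?e = "esssup ?M (\<lambda>t. ereal \<bar>?k t\<bar>)"
    define C where "C = Linf_norm a b ?k"
    \<comment> \<open>Over a null space the essential supremum would be \<open>-\<infinity>\<close>.
      Positive measure bounds it below by 0, so its conversion to a real loses nothing.\<close>
    have "emeasure ?M (space ?M) \<noteq> 0"
      using assms(1,2) by (simp add: emeasure_restrict_space)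
    then have "0 = esssup ?M (\<lambda>t. 0 :: ereal)" by (rule esssup_const[symmetric])
    also have "\<dots> \<le> ?e" by (rule esssup_mono) auto
    finally have "?e = ereal C"
      using k by (cases ?e) (auto simp: C_def Linf_norm_def Linf_space_def)
    then have ae: "AE t in ?M. \<bar>?k t\<bar> \<le> C"
      using esssup_AE[of "\<lambda>t. ereal \<bar>?k t\<bar>" ?M] by simp
    have intK: "integrable ?M K" using K_powr(1)[of 1] K0 by simp
    have bd: "AE t in ?M. \<bar>K t * ?k t\<bar> \<le> K t * C"
      using ae by (rule eventually_mono) (auto simp: abs_mult K0 intro!: mult_left_mono)
    have int: "integrable ?M (\<lambda>t. K t * ?k t)"
    proof (rule Bochner_Integration.integrable_bound)
      show "integrable ?M (\<lambda>t. K t * C)" using intK by simp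
      show "AE t in ?M. norm (K t * ?k t) \<le> norm (K t * C)"
        using bd by (rule eventually_mono) auto
    qed simp
    have "(\<alpha> + \<beta>) * \<bar>\<tau>\<bar> \<le> (LINT t|?M. \<bar>K t * ?k t\<bar>)" by (rule repr[OF int])
    also have "\<dots> \<le> (LINT t|?M. K t * C)"
      using int intK bd by (intro integral_mono_AE) auto
    also have "\<dots> = (LINT t|?M. K t powr 1) * C" using K0 by simp
    \<comment> \<open>The 6 is \<open>2 powr q * (2 * q + 1)\<close> at
      \<open>q = 1\<close>.\<close>
    also have "\<dots> = (\<alpha> * (x - a)^2 + \<beta> * (b - x)^2) / 6 * C"
      using K_powr(2)[of 1] assms(1-4) by simp
    finally have "(\<alpha> + \<beta>) * \<bar>\<tau>\<bar> \<le> (\<alpha> * (x - a)^2 + \<beta> * (b - x)^2) / 6 * C" .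
    then show ?thesis using pos by (simp add: C_def[symmetric] field_simps)
  qed
  have p_case: "\<bar>\<tau>\<bar> \<le> 1 / (2 * q + 1) powr (1 / q)
         * (\<alpha> powr q * (x - a) powr (q + 1) + \<beta> powr q * (b - x) powr (q + 1)) powr (1 / q)
         * (Lp_norm p a b ?k / (2 * (\<alpha> + \<beta>)))"
    if pq: "p > 1" "1 / p + 1 / q = 1" and k: "?k \<in> Lp_space p a b" for p q
  proof -
    \<comment> \<open>That \<open>q\<close> exceeds 1 follows because \<open>1 / q\<close> lies
      strictly between 0 and 1; the degenerate \<open>q = 0\<close>, for which \<open>1 / q\<close>
      is 0, is thereby excluded.\<close>
    have "0 < 1 / p" "1 / p < 1" using pq(1) by auto
    then have "1 / q > 0" "1 / q < 1" using pq(2) by linarith+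
    then have q: "q > 1" by (simp add: divide_less_eq split: if_splits)
    define S where "S = \<alpha> powr q * (x - a) powr (q + 1) + \<beta> powr q * (b - x) powr (q + 1)"
    have "S \<ge> 0" by (simp add: S_def)
    have [measurable]: "?k \<in> borel_measurable ?M" and kint: "integrable ?M (\<lambda>t. \<bar>?k t\<bar> powr p)"
      using k by (simp_all add: Lp_space_def)
    have Kint: "integrable ?M (\<lambda>t. \<bar>K t\<bar> powr q)" using K_powr(1)[of q] q K0 by simp
    note H = Holder_inequality_powr[OF q pq(1) _ _ _ Kint kint]
    have "(\<alpha> + \<beta>) * \<bar>\<tau>\<bar> \<le> (LINT t|?M. \<bar>K t * ?k t\<bar>)"
      using pq by (intro repr H(1)) auto
    also have "\<dots> \<le> (LINT t|?M. \<bar>K t\<bar> powr q) powr (1 / q) * Lp_norm p a b ?k"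
      unfolding Lp_norm_def using pq by (intro H(2)) auto
    also have "(LINT t|?M. \<bar>K t\<bar> powr q) = S / (2 powr q * (2 * q + 1))"
      using K_powr(2)[of q] q K0 by (simp add: S_def)
    \<comment> \<open>The root of \<open>2 powr q\<close> is the 2 that ends up in the divisor
      \<open>2 * (\<alpha> + \<beta>)\<close>.\<close>
    also have "\<dots> powr (1 / q) = S powr (1 / q) / (2 * (2 * q + 1) powr (1 / q))"
      using q \<open>S \<ge> 0\<close> by (simp add: powr_divide powr_mult powr_powr)
    finally have "\<bar>\<tau>\<bar> \<le> S powr (1 / q) / (2 * (2 * q + 1) powr (1 / q)) * Lp_norm p a b ?k / (\<alpha> + \<beta>)"
      using pos by (simp only: pos_le_divide_eq mult.commute[of "\<bar>\<tau>\<bar>"])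
    moreover have "P / (2 * D) * N / s = 1 / D * P * (N / (2 * s))" for P D N s :: real by simp
    ultimately show ?thesis unfolding S_def[symmetric] by (simp only:)
  qed
  have one_case: "\<bar>\<tau>\<bar> \<le> (\<alpha> * (x - a) + \<beta> * (b - x) + \<bar>\<alpha> * (x - a) - \<beta> * (b - x)\<bar>)
         * (Lp_norm 1 a b ?k / (4 * (\<alpha> + \<beta>)))"
    if k: "?k \<in> Lp_space 1 a b"
  proof -
    have [measurable]: "?k \<in> borel_measurable ?M" and kint: "integrable ?M (\<lambda>t. \<bar>?k t\<bar>)"
      using k by (simp_all add: Lp_space_def)
    have norm: "Lp_norm 1 a b ?k = (LINT t|?M. \<bar>?k t\<bar>)" by (simp add: Lp_norm_def)
    have bd: "\<bar>K t * ?k t\<bar> \<le> m * \<bar>?k t\<bar>" if "t \<in> {a..b}" for t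
      using K0 Km[OF that] by (auto simp: abs_mult intro!: mult_right_mono)
    have int: "integrable ?M (\<lambda>t. K t * ?k t)"
    proof (rule Bochner_Integration.integrable_bound)
      show "integrable ?M (\<lambda>t. m * \<bar>?k t\<bar>)" using kint by simp
      show "AE t in ?M. norm (K t * ?k t) \<le> norm (m * \<bar>?k t\<bar>)"
        using bd by (intro AE_I2) (force simp: abs_le_iff)
    qed simp
    have "(\<alpha> + \<beta>) * \<bar>\<tau>\<bar> \<le> (LINT t|?M. \<bar>K t * ?k t\<bar>)" by (rule repr[OF int])
    also have "\<dots> \<le> (LINT t|?M. m * \<bar>?k t\<bar>)"
      using int kint bd by (intro integral_mono) auto
    also have "\<dots> = m * Lp_norm 1 a b ?k" by (simp add: norm)
    \<comment> \<open>A maximum is half of the sum plus the absolute difference; with the 2 already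
      in \<open>m\<close> this gives 4.\<close>
    also have "m = (\<alpha> * (x - a) + \<beta> * (b - x) + \<bar>\<alpha> * (x - a) - \<beta> * (b - x)\<bar>) / 4"
      unfolding m_def by (auto simp: max_def)
    finally show ?thesis using pos by (simp add: field_simps)
  qed
  show ?thesis using sup_case p_case one_case by blast
qed

end
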